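(* Let $N\ge2$, $1<p<2$, and let $K$ be an admissible weight on $B_1^c$ with $K\in L^\infty(A_1^R)$ for all $R>1$. Let $h\in X_Y^\ast$ with $\langle h,\varphi_1\rangle=0$. Then for any $M>0$ there exists $\tau_0>0$ such that for each $\tau>\tau_0$ we can find $v_+^\tau,v_-^\tau\in X^\bot$ such that $$\max\{J_h(\tau\varphi_1+v_+^\tau),\,J_h(-\tau\varphi_1+v_-^\tau)\}<-M.$$
   Context: Notation: $B_1^c=\{x\in\mathbb{R}^N:|x|>1\}$, $A_1^R=\{x\in\mathbb{R}^N:1<|x|<R\}$. $X=\mathcal{D}_0^{1,p}(B_1^c)$ is the completion of $C_c^1(B_1^c)$ with respect to $\|u\|=\left(\int_{B_1^c}|\nabla u|^p\,dx\right)^{1/p}$; $X^\ast$ is its dual and $\langle\cdot,\cdot\rangle$ the duality pairing. Admissible weight: $K\in L^1_{loc}(B_1^c)$, $K>0$ on a set of positive measure, and there is a positive measurable function $w$ on $(1,\infty)$ with $|K(x)|\le w(|x|)$ for a.e. $x\in B_1^c$ and $\int_1^\infty w(r)r^{p-1}\,dr<\infty$ if $p\ne N$, respectively $\int_1^\infty w(r)[r\log r]^{N-1}\,dr<\infty$ if $p=N$. Then $X$ embeds compactly into $L^p(B_1^c;w(|x|))$. First eigenpair (known facts): $\lambda_1:=\inf\{\int_{B_1^c}|\nabla u|^p\,dx: u\in X,\ \int_{B_1^c}K|u|^p\,dx=1\}>0$ is attained at a function $\varphi_1\in X$, positive a.e., which is a weak solution of $-\operatorname{div}(|\nabla u|^{p-2}\nabla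 u)=\lambda_1K|u|^{p-2}u$ in $B_1^c$, $u=0$ on $\partial B_1$; $\lambda_1$ is simple (all weak solutions in $X$ of this equation are the multiples of $\varphi_1$). $\varphi_1$ denotes this positive minimizer. When $K\in L^\infty(A_1^R)$ for all $R>1$, $\varphi_1\in C^1(B_1^c)$ and $\varphi_1>0$ in $B_1^c$. $X^\bot=\{u\in X:\int_{B_1^c}K\varphi_1^{p-1}u\,dx=0\}$. Let $\mathcal{A}=\{x\in B_1^c:\nabla\varphi_1(x)=0\}$, $Y=\{\phi\in C_c^1(B_1^c):\phi\text{ is constant on some neighbourhood of }\mathcal{A}\}$, and $X_Y^\ast=\{h\in X^\ast: h\not\equiv 0\text{ on }Y\}$. $J_h(u)=\frac1p\int_{B_1^c}|\nabla u|^p\,dx-\frac{\lambda_1}{p}\int_{B_1^c}K(x)|u|^p\,dx-\langle h,u\rangle$ for $u\in X$. *)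

theory Defs
  imports "HOL-Analysis.Analysis"
begin

definition ext_ball :: "'a::euclidean_space set"
  where "ext_ball = {x. 1 < norm x}"

definition annulus :: "real \<Rightarrow> 'a::euclidean_space set"
  where "annulus R = {x. 1 < norm x \<and> norm x < R}"

definition grad :: "('a::euclidean_space \<Rightarrow> real) \<Rightarrow> 'a \<Rightarrow> 'a"
  where "grad f x = (THE D. GDERIV f x :> D)"

definition C1_on :: "'a::euclidean_space set \<Rightarrow> ('a \<Rightarrow> real) \<Rightarrow> bool"
  where "C1_on S f \<longleftrightarrow> (\<forall>x\<in>S. f differentiable (at x)) \<and> continuous_on S (grad f)"

(* Test functions C_c^1 of the exterior domain, extended by 0 to the whole space. *)
definition C1c :: "('a::euclidean_space \<Rightarrow> real) set"
  where "C1c = {\<phi>. C1_on UNIV \<phi> \<and>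
    (\<exists>S. compact S \<and> S \<subseteq> ext_ball \<and> (\<forall>x. x \<notin> S \<longrightarrow> \<phi> x = 0))}"

definition L1loc :: "('a::euclidean_space \<Rightarrow> 'b::euclidean_space) \<Rightarrow> bool"
  where "L1loc f \<longleftrightarrow> (\<forall>S. compact S \<and> S \<subseteq> ext_ball \<longrightarrow> f absolutely_integrable_on S)"

definition is_weak_grad :: "('a::euclidean_space \<Rightarrow> real) \<Rightarrow> ('a \<Rightarrow> 'a) \<Rightarrow> bool"
  where "is_weak_grad u g \<longleftrightarrow> L1loc u \<and> L1loc g \<and>
    (\<forall>\<phi>\<in>C1c. (LINT x|lebesgue_on ext_ball. u x *\<^sub>R grad \<phi> x)
             = - (LINT x|lebesgue_on ext_ball. \<phi> x *\<^sub>R g x))"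

(* Weak gradients are unique up to null sets of the exterior domain, so the choice is immaterial
   below, where the weak gradient occurs only under integrals. *)
definition wgrad :: "('a::euclidean_space \<Rightarrow> real) \<Rightarrow> 'a \<Rightarrow> 'a"
  where "wgrad u = (SOME g. is_weak_grad u g)"

(* The completion of C_c^1 in the norm of grad u in L^p, realised as a function space: a sequence
   that is Cauchy in this norm converges in L^1_loc (Poincare inequality on annuli, since test
   functions vanish near the unit sphere), and its L^1_loc limit has as weak gradient the L^p limit
   of the gradients. The L^1_loc convergence excludes, e.g., nonzero constants. Elements are
   functions, not classes; values inside the closed unit ball and on null sets are irrelevant. *)
definition D01p :: "real \<Rightarrow> ('a::euclidean_space \<Rightarrow> real) set"
  where "D01p p = {u. L1loc u \<and> (\<exists>g. is_weak_grad u g) \<and>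
    integrable (lebesgue_on ext_ball) (\<lambda>x. norm (wgrad u x) powr p) \<and>
    (\<exists>\<phi>. (\<forall>n. \<phi> n \<in> C1c) \<and>
      (\<lambda>n. LINT x|lebesgue_on ext_ball. norm (grad (\<phi> n) x - wgrad u x) powr p)
        \<longlonglongrightarrow> 0 \<and>
      (\<forall>S. compact S \<and> S \<subseteq> ext_ball \<longrightarrow>
        (\<lambda>n. LINT x|lebesgue_on S. \<bar>\<phi> n x - u x\<bar>) \<longlonglongrightarrow> 0))}"

definition D01p_norm :: "real \<Rightarrow> ('a::euclidean_space \<Rightarrow> real) \<Rightarrow> real"
  where "D01p_norm p u = (LINT x|lebesgue_on ext_ball. norm (wgrad u x) powr p) powr (1 / p)"

(* Only the values of a functional on D01p p matter. Linearity and boundedness force h u = h v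
   whenever u and v agree a.e. on the exterior domain. *)
definition D01p_dual :: "real \<Rightarrow> (('a::euclidean_space \<Rightarrow> real) \<Rightarrow> real) set"
  where "D01p_dual p = {h.
    (\<forall>u\<in>D01p p. \<forall>v\<in>D01p p. h (\<lambda>x. u x + v x) = h u + h v) \<and>
    (\<forall>c. \<forall>u\<in>D01p p. h (\<lambda>x. c * u x) = c * h u) \<and>
    (\<exists>C. \<forall>u\<in>D01p p. \<bar>h u\<bar> \<le> C * D01p_norm p u)}"

definition admissible_weight :: "real \<Rightarrow> ('a::euclidean_space \<Rightarrow> real) \<Rightarrow> bool"
  where "admissible_weight p K \<longleftrightarrow> L1loc K \<and>
    emeasure lebesgue {x \<in> ext_ball. 0 < K x} > 0 \<and>
    (\<exists>w :: real \<Rightarrow> real. w \<in> borel_measurable (lebesgue_on {1<..}) \<and> (\<forall>r>1. 0 < w r) \<and>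
      (AE x in lebesgue_on ext_ball. \<bar>K x\<bar> \<le> w (norm x)) \<and>
      (if p = real DIM('a)
       then (\<lambda>r. w r * (r * ln r) ^ (DIM('a) - 1)) absolutely_integrable_on {1<..}
       else (\<lambda>r. w r * r powr (p - 1)) absolutely_integrable_on {1<..}))"

definition lambda1 :: "real \<Rightarrow> ('a::euclidean_space \<Rightarrow> real) \<Rightarrow> real"
  where "lambda1 p K = Inf {LINT x|lebesgue_on ext_ball. norm (wgrad u x) powr p | u.
    u \<in> D01p p \<and> (LINT x|lebesgue_on ext_ball. K x * \<bar>u x\<bar> powr p) = 1}"

(* The positive minimizer, taken in its C^1 representative; pointwise values of its classical
   gradient are needed to define its critical set. *)
definition first_eigenfunction ::
    "real \<Rightarrow> ('a::euclidean_space \<Rightarrow> real) \<Rightarrow> ('a \<Rightarrow> real) \<Rightarrow> bool"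
  where "first_eigenfunction p K \<phi>1 \<longleftrightarrow> \<phi>1 \<in> D01p p \<and>
    (LINT x|lebesgue_on ext_ball. K x * \<bar>\<phi>1 x\<bar> powr p) = 1 \<and>
    (LINT x|lebesgue_on ext_ball. norm (wgrad \<phi>1 x) powr p) = lambda1 p K \<and>
    C1_on ext_ball \<phi>1 \<and> (\<forall>x\<in>ext_ball. 0 < \<phi>1 x)"

definition X_perp ::
    "real \<Rightarrow> ('a::euclidean_space \<Rightarrow> real) \<Rightarrow> ('a \<Rightarrow> real) \<Rightarrow> ('a \<Rightarrow> real) set"
  where "X_perp p K \<phi>1 = {u \<in> D01p p.
    (LINT x|lebesgue_on ext_ball. K x * \<phi>1 x powr (p - 1) * u x) = 0}"

definition crit_set :: "('a::euclidean_space \<Rightarrow> real) \<Rightarrow> 'a set"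
  where "crit_set \<phi>1 = {x \<in> ext_ball. grad \<phi>1 x = 0}"

definition Y_space :: "('a::euclidean_space \<Rightarrow> real) \<Rightarrow> ('a \<Rightarrow> real) set"
  where "Y_space \<phi>1 = {\<phi> \<in> C1c. \<exists>U. open U \<and> crit_set \<phi>1 \<subseteq> U \<and> \<phi> constant_on U}"

definition X_Y_dual ::
    "real \<Rightarrow> ('a::euclidean_space \<Rightarrow> real) \<Rightarrow> (('a \<Rightarrow> real) \<Rightarrow> real) set"
  where "X_Y_dual p \<phi>1 = {h \<in> D01p_dual p. \<exists>\<phi>\<in>Y_space \<phi>1. h \<phi> \<noteq> 0}"

definition J_fun :: "real \<Rightarrow> ('a::euclidean_space \<Rightarrow> real) \<Rightarrow> (('a \<Rightarrow> real) \<Rightarrow> real)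
    \<Rightarrow> ('a \<Rightarrow> real) \<Rightarrow> real"
  where "J_fun p K h u =
    1 / p * (LINT x|lebesgue_on ext_ball. norm (wgrad u x) powr p)
    - lambda1 p K / p * (LINT x|lebesgue_on ext_ball. K x * \<bar>u x\<bar> powr p)
    - h u"

end

theory Submission
  imports Defs
begin

text \<open>Take a test function \<open>\<phi>\<close> in \<open>Y\<close> with \<open>h \<phi> \<noteq> 0\<close>, multiplied by \<open>t\<close> so that \<open>t h(\<phi>) = M + 1\<close>,
  and let \<open>v\<close> be its projection along \<open>\<phi>1\<close> onto \<open>X_perp\<close>; since \<open>h \<phi>1 = 0\<close> the projection does not
  change \<open>h\<close>. It remains to see that the \<open>p\<close>-homogeneous energy \<open>E\<close> vanishes along
  \<open>s \<phi>1 + t \<phi>\<close> as \<open>s\<close> tends to \<open>\<plusminus>\<infinity>\<close>. As \<open>\<phi>\<close> is constant near the critical set of \<open>\<phi>1\<close>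
  and \<open>\<phi>1 > 0\<close>, one has \<open>E(\<phi>1 + e \<phi>) \<le> A e + B e\<^sup>2\<close> for all \<open>e\<close>. Minimality of \<open>\<phi>1\<close> makes the left side
  nonnegative, so \<open>A = 0\<close>, which replaces the Euler-Lagrange equation. Homogeneity gives
  \<open>E(s \<phi>1 + t \<phi>) \<le> B t\<^sup>2 \<bar>s\<bar> powr (p - 2)\<close>, which tends to \<open>0\<close> because \<open>p < 2\<close>.\<close>

subsection \<open>Continuously differentiable functions\<close>

text \<open>The exponent \<open>p - 2\<close> is negative, so the second-order coefficient
  \<open>norm (grad \<phi>1 x) powr (p - 2)\<close> blows up at the critical points of
  \<open>\<phi>1\<close>. The perturbation is taken from \<open>Y_space\<close> because its gradient
  vanishes near the critical set: the coefficient then matters only on a compact set where it is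
  bounded. The same negative exponent later produces the decay in \<open>s\<close>. The weight
  \<open>K\<close> may change sign, so the potential term needs two-sided control of the remainder
  of \<open>\<bar>\<phi>1 x + e * \<phi> x\<bar> powr p\<close> after its linear part: convexity
  bounds it from below, concavity in the square bounds it from above, in both cases for every real
  \<open>e\<close>. Much of the development links two kinds of gradient. The energy is written with
  \<open>wgrad\<close>, a choice of some weak gradient, while the inequalities concern the classical
  gradient of \<open>\<phi>1\<close>. Integration by parts makes the classical gradient a weak one,
  and the fundamental lemma of the calculus of variations makes weak gradients unique almost
  everywhere. Minimality and homogeneity moreover require \<open>D01p\<close> to be closed under
  linear combinations.\<close>

lemma open_ext_ball: "open ext_ball"
  unfolding ext_ball_def by (intro open_Collect_less continuous_intros)

lemma ext_ball_sets [simp]: "ext_ball \<in> sets lebesgue"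
  by (rule sets_completionI_sets) (simp add: borel_open open_ext_ball)

text \<open>\<open>grad\<close> is a definite description. Existence comes from the vector whose
  coordinates are the values of the derivative on \<open>Basis\<close>, uniqueness from comparing
  two inner-product functionals.\<close>

lemma GDERIV_grad:
  assumes "f differentiable (at x)"
  shows "GDERIV f x :> grad f x"
proof -
  obtain f' where f': "(f has_derivative f') (at x)"
    using assms by (auto simp: differentiable_def)
  then have lin: "linear f'" by (rule has_derivative_linear)
  have "f' h = h \<bullet> (\<Sum>b\<in>Basis. f' b *\<^sub>R b)" for h
  proof -
    have "f' h = f' (\<Sum>b\<in>Basis. (h \<bullet> b) *\<^sub>R b)" by (simp add: euclidean_representation)
    also have "\<dots> = (\<Sum>b\<in>Basis. (h \<bullet> b) * f' b)"
      by (simp add: linear_sum[OF lin] linear_scale[OF lin])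
    finally show ?thesis by (simp add: inner_sum_right mult.commute)
  qed
  then have D: "GDERIV f x :> (\<Sum>b\<in>Basis. f' b *\<^sub>R b)"
    using f' unfolding gderiv_def by (metis (no_types, lifting) ext)
  have uniq: "D1 = D2" if "GDERIV f x :> D1" "GDERIV f x :> D2" for D1 D2
    using has_derivative_unique[OF that[unfolded gderiv_def]] by (metis vector_eq_ldot)
  show ?thesis unfolding grad_def by (rule theI[where P = "\<lambda>D. GDERIV f x :> D", OF D uniq[OF _ D]])
qed

lemma grad_eqI:
  assumes "GDERIV f x :> D"
  shows "grad f x = D"
proof -
  have "f differentiable (at x)" using assms by (auto simp: gderiv_def differentiable_def)
  then have "(\<lambda>h. h \<bullet> grad f x) = (\<lambda>h. h \<bullet> D)"
    by (rule has_derivative_unique[OF GDERIV_grad[unfolded gderiv_def] assms[unfolded gderiv_def]])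
  then show ?thesis using vector_eq_ldot[of "grad f x" D] by metis
qed

lemma C1_onI:
  assumes "\<And>x. x \<in> S \<Longrightarrow> GDERIV f x :> G x" and "continuous_on S G"
  shows "C1_on S f"
proof -
  have "continuous_on S (grad f) \<longleftrightarrow> continuous_on S G"
    by (intro continuous_on_cong) (auto intro: grad_eqI assms(1))
  then show ?thesis using assms unfolding C1_on_def gderiv_def differentiable_def by blast
qed

lemma C1_onD:
  assumes "C1_on S f"
  shows "\<And>x. x \<in> S \<Longrightarrow> GDERIV f x :> grad f x" "continuous_on S (grad f)" "continuous_on S f"
proof -
  show "\<And>x. x \<in> S \<Longrightarrow> GDERIV f x :> grad f x" "continuous_on S (grad f)"
    using assms GDERIV_grad by (auto simp: C1_on_def)
  show "continuous_on S f"
    using assms unfolding C1_on_def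
    by (intro continuous_at_imp_continuous_on ballI differentiable_imp_continuous_within) auto
qed

lemma C1_on_subset: "C1_on S f \<Longrightarrow> T \<subseteq> S \<Longrightarrow> C1_on T f"
  unfolding C1_on_def using continuous_on_subset[of S "grad f" T] by auto

lemma C1_on_const: "C1_on S (\<lambda>x. c)"
  by (rule C1_onI[where G = "\<lambda>x. 0"]) (rule GDERIV_const continuous_on_const)+

lemma C1_on_mult:
  assumes "C1_on S f" "C1_on S g"
  shows "C1_on S (\<lambda>x. f x * g x)"
proof (rule C1_onI)
  show "GDERIV (\<lambda>x. f x * g x) x :> f x *\<^sub>R grad g x + g x *\<^sub>R grad f x" if "x \<in> S" for x
    by (rule GDERIV_mult[OF C1_onD(1)[OF assms(1) that] C1_onD(1)[OF assms(2) that]])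
  show "continuous_on S (\<lambda>x. f x *\<^sub>R grad g x + g x *\<^sub>R grad f x)"
    using C1_onD(2,3)[OF assms(1)] C1_onD(2,3)[OF assms(2)] by (intro continuous_intros)
qed

lemma C1_on_prod:
  assumes "finite I" "\<And>i. i \<in> I \<Longrightarrow> C1_on S (f i)"
  shows "C1_on S (\<lambda>x. \<Prod>i\<in>I. f i x)"
  using assms
proof (induction I rule: finite_induct)
  case empty
  then show ?case using C1_on_const[of S 1] by simp
next
  case (insert i I)
  then show ?case using C1_on_mult[of S "f i" "\<lambda>x. \<Prod>i\<in>I. f i x"] by simp
qed

lemma C1_on_compose:
  fixes g g' :: "real \<Rightarrow> real"
  assumes f: "C1_on S f" and g: "\<And>y. DERIV g y :> g' y" and g': "continuous_on UNIV g'"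
  shows "C1_on S (\<lambda>x. g (f x))"
proof (rule C1_onI)
  show "GDERIV (\<lambda>x. g (f x)) x :> g' (f x) *\<^sub>R grad f x" if "x \<in> S" for x
    by (rule GDERIV_DERIV_compose[OF C1_onD(1)[OF f that] g])
  show "continuous_on S (\<lambda>x. g' (f x) *\<^sub>R grad f x)"
    using C1_onD(2,3)[OF f] continuous_on_compose2[OF g' C1_onD(3)[OF f] subset_UNIV]
    by (intro continuous_intros)
qed

lemma GDERIV_lincomb:
  assumes "GDERIV f x :> df" "GDERIV g x :> dg"
  shows "GDERIV (\<lambda>x. a * f x + b * g x) x :> a *\<^sub>R df + b *\<^sub>R dg"
  using GDERIV_add[OF GDERIV_mult[OF GDERIV_const[of a x] assms(1)]
      GDERIV_mult[OF GDERIV_const[of b x] assms(2)]] by simp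

lemma C1_on_lincomb:
  assumes "C1_on S f" "C1_on S g"
  shows "C1_on S (\<lambda>x. a * f x + b * g x)"
proof (rule C1_onI)
  show "GDERIV (\<lambda>x. a * f x + b * g x) x :> a *\<^sub>R grad f x + b *\<^sub>R grad g x" if "x \<in> S" for x
    by (rule GDERIV_lincomb[OF C1_onD(1)[OF assms(1) that] C1_onD(1)[OF assms(2) that]])
  show "continuous_on S (\<lambda>x. a *\<^sub>R grad f x + b *\<^sub>R grad g x)"
    using C1_onD(2)[OF assms(1)] C1_onD(2)[OF assms(2)] by (intro continuous_intros)
qed

lemma grad_eq_0_outside:
  assumes "closed S" "\<And>x. x \<notin> S \<Longrightarrow> f x = 0" "x \<notin> S"
  shows "GDERIV f x :> 0" "grad f x = 0"
proof -
  have "((\<lambda>x. 0) has_derivative (\<lambda>h. h \<bullet> 0)) (at x)" by simp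
  then have "(f has_derivative (\<lambda>h. h \<bullet> 0)) (at x)"
    by (rule has_derivative_transform_within_open[where s = "- S"]) (use assms in auto)
  then show "GDERIV f x :> 0" by (simp add: gderiv_def)
  then show "grad f x = 0" by (rule grad_eqI)
qed

lemma C1cE:
  assumes "\<phi> \<in> C1c"
  obtains S where "C1_on UNIV \<phi>" "compact S" "S \<subseteq> ext_ball" "\<And>x. x \<notin> S \<Longrightarrow> \<phi> x = 0"
    "\<And>x. x \<notin> S \<Longrightarrow> grad \<phi> x = 0"
proof -
  obtain S where S: "C1_on UNIV \<phi>" "compact S" "S \<subseteq> ext_ball" "\<And>x. x \<notin> S \<Longrightarrow> \<phi> x = 0"
    using assms unfolding C1c_def by blast
  show ?thesis
    by (rule that[OF S]) (use S grad_eq_0_outside[of S \<phi>] in \<open>auto simp: compact_imp_closed\<close>)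
qed

lemma C1c_lincomb:
  assumes "\<phi> \<in> C1c" "\<psi> \<in> C1c"
  shows "(\<lambda>x. a * \<phi> x + b * \<psi> x) \<in> C1c"
proof -
  obtain S where S: "C1_on UNIV \<phi>" "compact S" "S \<subseteq> ext_ball" "\<And>x. x \<notin> S \<Longrightarrow> \<phi> x = 0"
    using C1cE[OF assms(1)] by metis
  obtain T where T: "C1_on UNIV \<psi>" "compact T" "T \<subseteq> ext_ball" "\<And>x. x \<notin> T \<Longrightarrow> \<psi> x = 0"
    using C1cE[OF assms(2)] by metis
  have "compact (S \<union> T)" "S \<union> T \<subseteq> ext_ball" "\<forall>x. x \<notin> S \<union> T \<longrightarrow> a * \<phi> x + b * \<psi> x = 0"
    using S T by (auto simp: compact_Un)
  then show ?thesis unfolding C1c_def using C1_on_lincomb[OF S(1) T(1)] by blast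
qed

section \<open>C1 test functions supported in boxes\<close>

lemma DERIV_pos_part_sq: "DERIV (\<lambda>y::real. (max 0 y)\<^sup>2) y :> 2 * max 0 y"
proof -
  consider "y < 0" | "y > 0" | "y = 0" by linarith
  then show ?thesis
  proof cases
    case 1
    have "DERIV (\<lambda>y::real. 0) y :> 0" by simp
    then have "DERIV (\<lambda>y::real. (max 0 y)\<^sup>2) y :> 0"
      by (rule has_field_derivative_transform_within_open[where S = "{..<0}"]) (use 1 in auto)
    then show ?thesis using 1 by simp
  next
    case 2
    have "DERIV (\<lambda>y::real. y\<^sup>2) y :> 2 * y" by (auto intro!: derivative_eq_intros)
    then have "DERIV (\<lambda>y::real. (max 0 y)\<^sup>2) y :> 2 * y"
      by (rule has_field_derivative_transform_within_open[where S = "{0<..}"]) (use 2 in auto)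
    then show ?thesis using 2 by simp
  next
    case 3
    \<comment> \<open>At the corner of the positive part, squaring makes the difference quotient at
      most \<open>\<bar>h\<bar>\<close> in absolute value.\<close>
    have "(\<lambda>h::real. (max 0 h)\<^sup>2 / h) \<midarrow>0\<rightarrow> 0"
    proof (rule Lim_null_comparison)
      show "\<forall>\<^sub>F h::real in at 0. norm ((max 0 h)\<^sup>2 / h) \<le> \<bar>h\<bar>"
        by (rule always_eventually) (auto simp: max_def power2_eq_square)
      show "((\<lambda>h::real. \<bar>h\<bar>) \<longlongrightarrow> 0) (at 0)" by (auto intro!: tendsto_eq_intros)
    qed
    then show ?thesis using 3 by (simp add: DERIV_def)
  qed
qed

text \<open>The squares make every factor C1 across the faces of the box, so the function is C1 on
  the whole space although it vanishes outside the open box.\<close>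

definition box_bump :: "'a::euclidean_space \<Rightarrow> 'a \<Rightarrow> 'a \<Rightarrow> real"
  where "box_bump a b x = (\<Prod>i\<in>Basis. (max 0 (x \<bullet> i - a \<bullet> i))\<^sup>2 * (max 0 (b \<bullet> i - x \<bullet> i))\<^sup>2)"

lemma C1_on_box_bump: "C1_on S (box_bump a b)"
proof -
  have d: "((\<lambda>x. x \<bullet> i) has_derivative (\<lambda>h. h \<bullet> i)) (at x)" for i x :: 'a
    by (rule bounded_linear_imp_has_derivative) (rule bounded_linear_inner_left)
  have aff: "C1_on S (\<lambda>x. x \<bullet> i - c)" "C1_on S (\<lambda>x. c - x \<bullet> i)" for i :: 'a and c
    using GDERIV_diff[OF d[of i, folded gderiv_def] GDERIV_const[of c]]
      GDERIV_diff[OF GDERIV_const[of c] d[of i, folded gderiv_def]]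
    by (auto intro: C1_onI[where G = "\<lambda>x. i"] C1_onI[where G = "\<lambda>x. - i"])
  have sq: "C1_on S (\<lambda>x. (max 0 (f x))\<^sup>2)" if "C1_on S f" for f :: "'a \<Rightarrow> real"
    by (rule C1_on_compose[OF that DERIV_pos_part_sq]) (auto intro!: continuous_intros)
  show ?thesis
    unfolding box_bump_def[abs_def] by (intro C1_on_prod C1_on_mult sq aff) auto
qed

lemma box_bump_pos: "x \<in> box a b \<Longrightarrow> box_bump a b x > 0"
  by (auto simp: box_bump_def mem_box intro!: prod_pos)

lemma box_bump_eq_0:
  assumes "x \<notin> box a b"
  shows "box_bump a b x = 0"
proof -
  obtain i where i: "i \<in> Basis" "x \<bullet> i \<le> a \<bullet> i \<or> b \<bullet> i \<le> x \<bullet> i"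
    using assms by (auto simp: mem_box not_less)
  then have "(max 0 (x \<bullet> i - a \<bullet> i))\<^sup>2 * (max 0 (b \<bullet> i - x \<bullet> i))\<^sup>2 = 0"
    by (auto simp: max_def)
  then show ?thesis unfolding box_bump_def using i(1) by (intro prod_zero) auto
qed

lemma box_bump_nonneg: "box_bump a b x \<ge> 0"
  by (auto simp: box_bump_def intro!: prod_nonneg)

text \<open>For \<open>c \<ge> 0\<close> the values lie between 0 and 1, and as \<open>c\<close>
  grows the functions tend pointwise to the indicator of the open box. They are the test functions
  that detect integrals over boxes.\<close>

lemma one_minus_exp_bump_C1c:
  assumes "cbox a b \<subseteq> ext_ball"
  shows "(\<lambda>x. 1 - exp (- c * box_bump a b x)) \<in> C1c"
proof -
  have "C1_on UNIV (\<lambda>x. 1 - exp (- c * box_bump a b x))"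
    by (rule C1_on_compose[OF C1_on_box_bump, where g' = "\<lambda>y. c * exp (- c * y)"])
       (auto intro!: derivative_eq_intros continuous_intros)
  moreover have "\<forall>x. x \<notin> cbox a b \<longrightarrow> 1 - exp (- c * box_bump a b x) = 0"
    using box_bump_eq_0 box_subset_cbox by fastforce
  ultimately show ?thesis
    using assms compact_cbox unfolding C1c_def by blast
qed

subsection \<open>Locally integrable functions\<close>

abbreviation ext_leb :: "'a::euclidean_space measure"
  where "ext_leb \<equiv> lebesgue_on ext_ball"

text \<open>A compact exhaustion of the exterior domain, used to pass from properties on compact
  subsets to the whole domain.\<close>

definition shell :: "nat \<Rightarrow> 'a::euclidean_space set"
  where "shell n = {x. 1 + inverse (Suc n) \<le> norm x \<and> norm x \<le> Suc n}"

lemma compact_shell: "compact (shell n)"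
proof -
  have "shell n = cball 0 (Suc n) \<inter> {x. 1 + inverse (Suc n) \<le> norm x}"
    by (auto simp: shell_def)
  moreover have "closed {x::'a. 1 + inverse (Suc n) \<le> norm x}"
    by (intro closed_Collect_le continuous_intros)
  ultimately show ?thesis by (metis compact_Int_closed compact_cball)
qed

lemma shell_subset: "shell n \<subseteq> ext_ball"
proof
  fix x :: 'a assume "x \<in> shell n"
  moreover have "inverse (real (Suc n)) > 0" by simp
  ultimately show "x \<in> ext_ball" unfolding shell_def ext_ball_def by (smt (verit) mem_Collect_eq)
qed

text \<open>The inequalities are strict so that a whole neighbourhood of \<open>x\<close> lies in
  the shell; the differentiation argument in \<open>L1loc_eq_0_AE\<close> relies on this.\<close>

lemma eventually_in_shell:
  assumes "x \<in> ext_ball"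
  shows "\<forall>\<^sub>F n in sequentially. 1 + inverse (Suc n) < norm x \<and> norm x < Suc n"
proof -
  have "(\<lambda>n. 1 + inverse (real (Suc n))) \<longlonglongrightarrow> 1 + 0"
    by (intro tendsto_intros LIMSEQ_inverse_real_of_nat)
  then have "\<forall>\<^sub>F n in sequentially. 1 + inverse (Suc n) < norm x"
    using assms by (intro order_tendstoD(2)) (auto simp: ext_ball_def)
  moreover have "\<forall>\<^sub>F n in sequentially. norm x < Suc n"
    using filterlim_at_top_dense[THEN iffD1, OF filterlim_compose[OF filterlim_real_sequentially filterlim_Suc]]
    by auto
  ultimately show ?thesis by eventually_elim auto
qed

lemma integrable_ext_indicator:
  fixes f :: "'a::euclidean_space \<Rightarrow> 'b::euclidean_space"
  assumes "set_integrable lebesgue S f" "S \<subseteq> ext_ball"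
  shows "integrable ext_leb (\<lambda>x. indicator S x *\<^sub>R f x)"
proof -
  have "indicator ext_ball x *\<^sub>R (indicator S x *\<^sub>R f x) = indicator S x *\<^sub>R f x" for x
    using assms(2) by (auto simp: indicator_def)
  moreover have "integrable ext_leb (\<lambda>x. indicator S x *\<^sub>R f x) \<longleftrightarrow>
      integrable lebesgue (\<lambda>x. indicator ext_ball x *\<^sub>R (indicator S x *\<^sub>R f x))"
    by (rule integrable_restrict_space) simp
  ultimately show ?thesis
    using assms(1) by (simp only: set_integrable_def)
qed

text \<open>At each point the truncations to shells eventually equal \<open>f\<close>, so
  \<open>f\<close> is a pointwise limit of integrable functions.\<close>

lemma L1loc_measurable:
  assumes "L1loc f"
  shows "f \<in> borel_measurable ext_leb"
proof (rule borel_measurable_LIMSEQ_metric)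
  show "(\<lambda>x. indicator (shell n) x *\<^sub>R f x) \<in> borel_measurable ext_leb" for n
    using assms compact_shell shell_subset unfolding L1loc_def
    by (intro borel_measurable_integrable integrable_ext_indicator) auto
  fix x :: 'a assume "x \<in> space ext_leb"
  then have "\<forall>\<^sub>F n in sequentially. 1 + inverse (Suc n) < norm x \<and> norm x < Suc n"
    by (intro eventually_in_shell) simp
  then have "\<forall>\<^sub>F n in sequentially. indicator (shell n) x *\<^sub>R f x = f x"
    by eventually_elim (auto simp: shell_def)
  then show "(\<lambda>n. indicator (shell n) x *\<^sub>R f x) \<longlonglongrightarrow> f x"
    by (rule tendsto_eventually)
qed

lemma continuous_ext_measurable:
  fixes f :: "'a::euclidean_space \<Rightarrow> 'b::euclidean_space"
  shows "continuous_on ext_ball f \<Longrightarrow> f \<in> borel_measurable ext_leb"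
  by (simp add: continuous_imp_measurable_on_sets_lebesgue)

lemma continuous_on_L1loc:
  fixes f :: "'a::euclidean_space \<Rightarrow> 'b::euclidean_space"
  assumes "continuous_on ext_ball f"
  shows "L1loc f"
  unfolding L1loc_def
proof (intro allI impI)
  fix S :: "'a set" assume S: "compact S \<and> S \<subseteq> ext_ball"
  then have "integrable lborel (\<lambda>x. indicator S x *\<^sub>R f x)"
    using assms by (intro borel_integrable_compact) (auto intro: continuous_on_subset)
  then show "f absolutely_integrable_on S"
    using integrable_completion borel_measurable_integrable unfolding set_integrable_def by metis
qed

lemma integrable_dominated_compact:
  fixes f :: "'a::euclidean_space \<Rightarrow> 'b::euclidean_space" and F :: "'a \<Rightarrow> 'c::euclidean_space"
  assumes f: "L1loc f" and S: "compact S" "S \<subseteq> ext_ball"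
    and F: "F \<in> borel_measurable ext_leb"
    and le: "\<And>x. x \<in> S \<Longrightarrow> norm (F x) \<le> C * norm (f x)"
    and out: "\<And>x. x \<in> ext_ball \<Longrightarrow> x \<notin> S \<Longrightarrow> F x = 0"
  shows "integrable ext_leb F"
proof (rule Bochner_Integration.integrable_bound[OF _ F])
  show "integrable ext_leb (\<lambda>x. C * norm (indicator S x *\<^sub>R f x))"
    using f S unfolding L1loc_def
    by (intro integrable_mult_right integrable_norm integrable_ext_indicator) auto
  show "AE x in ext_leb. norm (F x) \<le> norm (C * norm (indicator S x *\<^sub>R f x))"
  proof (rule AE_I2)
    fix x :: 'a assume x: "x \<in> space ext_leb"
    show "norm (F x) \<le> norm (C * norm (indicator S x *\<^sub>R f x))"
    proof (cases "x \<in> S")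
      case True
      then have "norm (F x) \<le> \<bar>C * norm (f x)\<bar>" using le[OF True] by linarith
      then show ?thesis using True by (simp add: abs_mult)
    qed (use out x in auto)
  qed
qed

lemma integrable_mult_compact:
  fixes f :: "'a::euclidean_space \<Rightarrow> 'b::euclidean_space"
  assumes f: "L1loc f" and S: "compact S" "S \<subseteq> ext_ball"
    and k: "continuous_on ext_ball k" and out: "\<And>x. x \<in> ext_ball \<Longrightarrow> x \<notin> S \<Longrightarrow> k x = 0"
  shows "integrable ext_leb (\<lambda>x. k x *\<^sub>R f x)"
proof -
  have "bounded (k ` S)"
    using k S by (intro compact_imp_bounded compact_continuous_image) (auto intro: continuous_on_subset)
  then obtain C where C: "\<And>x. x \<in> S \<Longrightarrow> \<bar>k x\<bar> \<le> C" by (auto simp: bounded_iff)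
  show ?thesis
  proof (rule integrable_dominated_compact[OF f S])
    show "(\<lambda>x. k x *\<^sub>R f x) \<in> borel_measurable ext_leb"
      using L1loc_measurable[OF f] continuous_ext_measurable[OF k] by measurable
    show "norm (k x *\<^sub>R f x) \<le> C * norm (f x)" if "x \<in> S" for x
      using C[OF that] by (simp add: mult_right_mono)
  qed (use out in auto)
qed

text \<open>Here the locally integrable factor is the scalar and the continuous one the vector, as
  in \<open>u x *\<^sub>R grad \<phi> x\<close>.\<close>

lemma integrable_mult_compact':
  fixes f :: "'a::euclidean_space \<Rightarrow> real" and k :: "'a \<Rightarrow> 'b::euclidean_space"
  assumes f: "L1loc f" and S: "compact S" "S \<subseteq> ext_ball"
    and k: "continuous_on ext_ball k" and out: "\<And>x. x \<in> ext_ball \<Longrightarrow> x \<notin> S \<Longrightarrow> k x = 0"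
  shows "integrable ext_leb (\<lambda>x. f x *\<^sub>R k x)"
proof -
  have "bounded (k ` S)"
    using k S by (intro compact_imp_bounded compact_continuous_image) (auto intro: continuous_on_subset)
  then obtain C where C: "\<And>x. x \<in> S \<Longrightarrow> norm (k x) \<le> C" by (auto simp: bounded_iff)
  show ?thesis
  proof (rule integrable_dominated_compact[OF f S])
    show "(\<lambda>x. f x *\<^sub>R k x) \<in> borel_measurable ext_leb"
      using L1loc_measurable[OF f] continuous_ext_measurable[OF k] by measurable
    show "norm (f x *\<^sub>R k x) \<le> C * norm (f x)" if "x \<in> S" for x
      using mult_left_mono[OF C[OF that], of "norm (f x)"] by (simp add: mult.commute)
  qed (use out in auto)
qed

lemma L1loc_lincomb:
  fixes f g :: "'a::euclidean_space \<Rightarrow> 'b::euclidean_space"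
  assumes "L1loc f" "L1loc g"
  shows "L1loc (\<lambda>x. a *\<^sub>R f x + b *\<^sub>R g x)"
  using assms unfolding L1loc_def
  by (auto intro!: set_integral_add absolutely_integrable_scaleR_left)

section \<open>The fundamental lemma of the calculus of variations\<close>

text \<open>The indicator of the open box is a pointwise limit of test functions with values between
  0 and 1, so dominated convergence, with \<open>g\<close> on the closed box as bound, carries the
  vanishing over. The faces of the box do not affect the integral.\<close>

lemma integral_cbox_eq_0_if_test:
  fixes g :: "'a::euclidean_space \<Rightarrow> 'b::euclidean_space"
  assumes g: "L1loc g" and z: "\<And>\<phi>. \<phi> \<in> C1c \<Longrightarrow> (LINT x|ext_leb. \<phi> x *\<^sub>R g x) = 0"
    and sub: "cbox a b \<subseteq> ext_ball"
  shows "integral (cbox a b) g = 0"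
proof -
  define \<phi> where "\<phi> n x = 1 - exp (- real n * box_bump a b x)" for n x
  have int: "integrable ext_leb (\<lambda>x. indicator (cbox a b) x *\<^sub>R g x)"
    using g sub unfolding L1loc_def by (intro integrable_ext_indicator) auto
  have \<phi>01: "0 \<le> \<phi> n x" "\<phi> n x \<le> 1" for n x
    by (auto simp: \<phi>_def box_bump_nonneg)
  have \<phi>0: "\<phi> n x = 0" if "x \<notin> box a b" for n x
    using box_bump_eq_0[OF that] by (simp add: \<phi>_def)
  have \<phi>C: "\<phi> n \<in> C1c" for n
    using one_minus_exp_bump_C1c[OF sub, of "real n"] by (simp add: \<phi>_def[abs_def])
  have gm: "g \<in> borel_measurable ext_leb" by (rule L1loc_measurable[OF g])
  have bm: "(\<lambda>x. indicator (box a b) x *\<^sub>R g x) \<in> borel_measurable ext_leb"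
  proof (intro borel_measurable_scaleR gm borel_measurable_indicator)
    show "box a b \<in> sets ext_leb"
    proof (subst sets_restrict_space_iff)
      have "box a b \<in> sets lebesgue" by (rule sets_completionI_sets) simp
      moreover have "box a b \<subseteq> ext_ball" using sub box_subset_cbox by (rule order_trans[rotated])
      ultimately show "box a b \<subseteq> ext_ball \<and> box a b \<in> sets lebesgue" by simp
    qed simp
  qed
  have "(\<lambda>n. LINT x|ext_leb. \<phi> n x *\<^sub>R g x) \<longlonglongrightarrow> (LINT x|ext_leb. indicator (box a b) x *\<^sub>R g x)"
  proof (rule integral_dominated_convergence[OF bm _ integrable_norm[OF int]])
    show "(\<lambda>x. \<phi> n x *\<^sub>R g x) \<in> borel_measurable ext_leb" for n
    proof (intro borel_measurable_scaleR gm continuous_ext_measurable)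
      show "continuous_on ext_ball (\<phi> n)"
        by (rule C1cE[OF \<phi>C[of n]], rule continuous_on_subset[OF C1_onD(3)]) auto
    qed
    show "AE x in ext_leb. (\<lambda>n. \<phi> n x *\<^sub>R g x) \<longlonglongrightarrow> indicator (box a b) x *\<^sub>R g x"
    proof (rule AE_I2)
      fix x
      have "(\<lambda>n. \<phi> n x) \<longlonglongrightarrow> indicator (box a b) x"
      proof (cases "x \<in> box a b")
        case True
        then have "box_bump a b x > 0" by (rule box_bump_pos)
        then have "exp (- box_bump a b x) < 1" by simp
        then have "(\<lambda>n. 1 - exp (- box_bump a b x) ^ n) \<longlonglongrightarrow> 1 - 0"
          by (intro tendsto_intros LIMSEQ_power_zero) simp
        \<comment> \<open>Inside the box this is \<open>1 - q ^ n\<close> with \<open>q < 1\<close>,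
          so the limit is that of a geometric sequence.\<close>
        moreover have "\<phi> n x = 1 - exp (- box_bump a b x) ^ n" for n
          unfolding \<phi>_def by (subst exp_of_nat_mult[symmetric]) simp
        ultimately show ?thesis using True by simp
      qed (simp add: \<phi>0)
      then show "(\<lambda>n. \<phi> n x *\<^sub>R g x) \<longlonglongrightarrow> indicator (box a b) x *\<^sub>R g x"
        by (intro tendsto_intros)
    qed
    show "AE x in ext_leb. norm (\<phi> n x *\<^sub>R g x) \<le> norm (indicator (cbox a b) x *\<^sub>R g x)" for n
    proof (rule AE_I2)
      fix x
      show "norm (\<phi> n x *\<^sub>R g x) \<le> norm (indicator (cbox a b) x *\<^sub>R g x)"
      proof (cases "x \<in> box a b")
        case True
        then have "x \<in> cbox a b" using box_subset_cbox by blast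
        then show ?thesis using \<phi>01[of n x] by (simp add: mult_left_le_one_le)
      qed (simp add: \<phi>0)
    qed
  qed
  then have "(LINT x|ext_leb. indicator (box a b) x *\<^sub>R g x) = 0"
    by (simp only: z[OF \<phi>C] LIMSEQ_const_iff)
  moreover have ind: "indicator ext_ball x *\<^sub>R (indicator (box a b) x *\<^sub>R g x) = indicator (box a b) x *\<^sub>R g x" for x
    using sub box_subset_cbox[of a b] by (auto simp: indicator_def)
  moreover have "(LINT x|ext_leb. indicator (box a b) x *\<^sub>R g x) =
      (LINT x|lebesgue. indicator ext_ball x *\<^sub>R (indicator (box a b) x *\<^sub>R g x))"
    by (rule integral_restrict_space) simp
  ultimately have box0: "(LINT x:box a b|lebesgue. g x) = 0"
    unfolding set_lebesgue_integral_def ind by metis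
  have "g absolutely_integrable_on cbox a b"
    using g sub compact_cbox unfolding L1loc_def by blast
  then have "g absolutely_integrable_on box a b"
    by (rule set_integrable_subset) (simp_all add: box_subset_cbox)
  from set_lebesgue_integral_eq_integral(2)[OF this] have "integral (box a b) g = 0"
    using box0 by simp
  then show ?thesis by (simp add: integral_open_interval)
qed

text \<open>Integrals over boxes determine \<open>g\<close> by Lebesgue differentiation along cubes.\<close>

lemma L1loc_eq_0_AE:
  fixes g :: "'a::euclidean_space \<Rightarrow> 'b::euclidean_space"
  assumes g: "L1loc g" and z: "\<And>\<phi>. \<phi> \<in> C1c \<Longrightarrow> (LINT x|ext_leb. \<phi> x *\<^sub>R g x) = 0"
  shows "AE x in ext_leb. g x = 0"
proof -
  \<comment> \<open>Lebesgue differentiation is applied to a function integrable over every box,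
    whereas \<open>g\<close> is controlled only on compact subsets of the exterior domain; hence the
    truncation.\<close>
  define f where "f n x = (if x \<in> shell n then g x else 0)" for n x
  have "f n integrable_on cbox a b" for n and a b :: 'a
  proof -
    have "g absolutely_integrable_on shell n"
      using g compact_shell shell_subset unfolding L1loc_def by auto
    then have "(f n) absolutely_integrable_on UNIV"
      unfolding f_def using absolutely_integrable_restrict_UNIV by blast
    then have "(f n) absolutely_integrable_on cbox a b"
      by (rule set_integrable_subset) auto
    then show ?thesis using set_lebesgue_integral_eq_integral(1) by blast
  qed
  then have "\<exists>N. negligible N \<and> (\<forall>x e. x \<notin> N \<longrightarrow> 0 < e \<longrightarrow> (\<exists>d>0. \<forall>h. 0 < h \<and> h < d \<longrightarrow>
      norm (integral (cbox x (x + h *\<^sub>R One)) (f n) /\<^sub>R h ^ DIM('a) - f n x) < e))" for n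
    using integrable_ccontinuous_explicit[of "f n"] by metis
  then obtain N where N: "\<And>n. negligible (N n)"
    and leb: "\<And>n x e. x \<notin> N n \<Longrightarrow> 0 < e \<Longrightarrow> \<exists>d>0. \<forall>h. 0 < h \<and> h < d \<longrightarrow>
      norm (integral (cbox x (x + h *\<^sub>R One)) (f n) /\<^sub>R h ^ DIM('a) - f n x) < e"
    by metis
  \<comment> \<open>The shell that serves \<open>x\<close> depends on \<open>x\<close>, so the
    exceptional sets of all truncations are discarded at once.\<close>
  have "g x = 0" if x: "x \<in> ext_ball" "x \<notin> (\<Union>n. N n)" for x
  proof -
    obtain n where n: "1 + inverse (Suc n) < norm x \<and> norm x < Suc n"
      using eventually_in_shell[OF x(1)] eventually_happens'[OF sequentially_bot] by blast
    define W where "W = {x::'a. 1 + inverse (Suc n) < norm x} \<inter> {x. norm x < Suc n}"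
    have "open W" "x \<in> W"
      unfolding W_def using n by (auto intro!: open_Int open_Collect_less continuous_intros)
    then obtain r where r: "r > 0" "ball x r \<subseteq> W" using open_contains_ball by blast
    have W: "W \<subseteq> shell n" by (auto simp: W_def shell_def)
    have "norm (f n x) < e" if e: "e > 0" for e
    proof -
      obtain d where d: "d > 0" "\<And>h. 0 < h \<Longrightarrow> h < d \<Longrightarrow>
        norm (integral (cbox x (x + h *\<^sub>R One)) (f n) /\<^sub>R h ^ DIM('a) - f n x) < e"
        using leb[of x n, OF _ e] x(2) by blast
      \<comment> \<open>The cube has diagonal \<open>h * norm One\<close>; this choice keeps it
        inside \<open>ball x r\<close>, where the truncation agrees with \<open>g\<close>, while
        \<open>h < d\<close> still holds.\<close>
      define h where "h = min (d / 2) (r / (2 * norm (One::'a)))"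
      have One: "norm (One::'a) > 0" by (simp add: One_non_0)
      have h: "0 < h" "h < d" using d(1) r(1) One by (auto simp: h_def)
      have "h * norm (One::'a) < r"
      proof -
        have "h \<le> r / (2 * norm (One::'a))" by (simp add: h_def)
        then have "h * norm (One::'a) \<le> r / 2" using One by (simp add: field_simps)
        then show ?thesis using r(1) by linarith
      qed
      have cb: "cbox x (x + h *\<^sub>R One) \<subseteq> ball x r"
      proof
        fix y assume y: "y \<in> cbox x (x + h *\<^sub>R One)"
        have "norm (y - x) \<le> norm (h *\<^sub>R (One::'a))"
        proof (rule norm_le_componentwise)
          fix i :: 'a assume i: "i \<in> Basis"
          have "0 \<le> (y - x) \<bullet> i" "(y - x) \<bullet> i \<le> h"
            using y i by (auto simp: mem_box inner_diff_left inner_add_left)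
          then show "\<bar>(y - x) \<bullet> i\<bar> \<le> \<bar>(h *\<^sub>R (One::'a)) \<bullet> i\<bar>" using i h by simp
        qed
        then show "y \<in> ball x r" using \<open>h * norm (One::'a) < r\<close> h
          by (simp add: dist_norm norm_minus_commute)
      qed
      then have sub: "cbox x (x + h *\<^sub>R One) \<subseteq> shell n" using r(2) W by blast
      have "integral (cbox x (x + h *\<^sub>R One)) (f n) = integral (cbox x (x + h *\<^sub>R One)) g"
        using sub by (intro integral_cong) (auto simp: f_def)
      also have "\<dots> = 0"
        using sub shell_subset by (intro integral_cbox_eq_0_if_test[OF g z]) auto
      finally show ?thesis using d(2)[OF h] by simp
    qed
    then have "f n x = 0" by (metis less_irrefl zero_less_norm_iff)
    then show "g x = 0" using \<open>x \<in> W\<close> W by (auto simp: f_def)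
  qed
  moreover have "negligible (\<Union>n. N n)" using N by (intro negligible_countable_Union) auto
  ultimately have "AE x in lebesgue. x \<in> ext_ball \<longrightarrow> g x = 0"
    unfolding negligible_iff_null_sets by (intro AE_I'[of "\<Union>n. N n"]) auto
  then show ?thesis by (subst AE_restrict_space_iff) auto
qed

subsection \<open>Weak gradients\<close>

text \<open>By translation invariance every difference quotient of \<open>F\<close> in direction
  \<open>e\<close> has integral zero. The quotients are bounded by the Lipschitz constant and live
  in a common ball, so the limit may be taken under the integral.\<close>

lemma LINT_grad_eq_0:
  fixes F :: "'a::euclidean_space \<Rightarrow> real"
  assumes F: "C1_on UNIV F" and S: "compact S" and out: "\<And>x. x \<notin> S \<Longrightarrow> F x = 0"
  shows "(LINT x|lborel. grad F x \<bullet> e) = 0"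
proof -
  define t where "t n = inverse (real (Suc n))" for n
  define q where "q n x = (F (t n *\<^sub>R e + x) - F x) / t n" for n x
  have t: "0 < t n" "t n \<le> 1" for n
    by (auto simp: t_def inverse_eq_divide)
  have gout: "grad F x = 0" if "x \<notin> S" for x
    using grad_eq_0_outside(2)[of S F x] S out that by (auto simp: compact_imp_closed)
  have contF: "continuous_on UNIV F" and contG: "continuous_on UNIV (grad F)"
    using C1_onD[OF F] by auto
  have "bounded (grad F ` S)"
    by (intro compact_imp_bounded compact_continuous_image continuous_on_subset[OF contG] S) auto
  then obtain L where L: "\<And>x. x \<in> S \<Longrightarrow> norm (grad F x) \<le> L" by (auto simp: bounded_iff)
  \<comment> \<open>If \<open>S\<close> is empty, nothing prevents \<open>L\<close> from being
    negative; hence the maximum.\<close>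
  have L': "norm (grad F x) \<le> max L 0" for x
    using L[of x] gout[of x] by (cases "x \<in> S") auto
  obtain r where r: "\<And>x. x \<in> S \<Longrightarrow> norm x \<le> r"
    using compact_imp_bounded[OF S] by (auto simp: bounded_iff)
  \<comment> \<open>The steps \<open>t n\<close> are at most 1, so a shift moves the support by at
    most \<open>norm e\<close> and all quotients vanish outside this ball.\<close>
  define R where "R = r + norm e"
  have lip: "\<bar>F y - F x\<bar> \<le> max L 0 * norm (y - x)" for x y
  proof -
    have "norm (F y - F x) \<le> max L 0 * norm (y - x)"
    proof (rule differentiable_bound[where S = UNIV and f' = "\<lambda>x h. h \<bullet> grad F x"])
      show "(F has_derivative (\<lambda>h. h \<bullet> grad F z)) (at z within UNIV)" for z
        using C1_onD(1)[OF F, of z] by (simp add: gderiv_def)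
      show "onorm (\<lambda>h. h \<bullet> grad F z) \<le> max L 0" for z
      proof (rule onorm_bound)
        fix h
        have "norm (h \<bullet> grad F z) \<le> norm h * norm (grad F z)" by (simp add: Cauchy_Schwarz_ineq2)
        also have "\<dots> \<le> norm h * max L 0" by (rule mult_left_mono[OF L']) simp
        finally show "norm (h \<bullet> grad F z) \<le> max L 0 * norm h" by (simp add: mult.commute)
      qed simp
    qed auto
    then show ?thesis by simp
  qed
  have Fm [measurable]: "F \<in> borel_measurable borel" and Gm [measurable]: "grad F \<in> borel_measurable borel"
    using contF contG by (auto intro: borel_measurable_continuous_onI)
  have "integrable lborel (\<lambda>x. indicator S x *\<^sub>R F x)"
    by (intro borel_integrable_compact S continuous_on_subset[OF contF]) auto
  moreover have "indicator S x *\<^sub>R F x = F x" for x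
    using out[of x] by (cases "x \<in> S") auto
  ultimately have intF: "integrable lborel F" by (simp only:)
  have intFs: "integrable lborel (\<lambda>x. F (c + x))" and LF: "(LINT x|lborel. F (c + x)) = (LINT x|lborel. F x)" for c
  proof -
    have "integrable (distr lborel borel ((+) c)) F" using intF by (simp add: lborel_distr_plus)
    then show "integrable lborel (\<lambda>x. F (c + x))" by (subst (asm) integrable_distr_eq) auto
    have "(LINT x|lborel. F (c + x)) = (LINT x|distr lborel borel ((+) c). F x)"
      by (subst integral_distr) auto
    then show "(LINT x|lborel. F (c + x)) = (LINT x|lborel. F x)" by (simp add: lborel_distr_plus)
  qed
  have q0: "(LINT x|lborel. q n x) = 0" for n
    unfolding q_def using intFs intF LF by simp
  have "(\<lambda>n. LINT x|lborel. q n x) \<longlonglongrightarrow> (LINT x|lborel. grad F x \<bullet> e)"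
  proof (rule integral_dominated_convergence)
    show "(\<lambda>x. grad F x \<bullet> e) \<in> borel_measurable lborel" by simp
    show "q n \<in> borel_measurable lborel" for n unfolding q_def[abs_def] by measurable
    show "integrable lborel (\<lambda>x. indicator (cball 0 R) x *\<^sub>R (max L 0 * norm e))"
      by (intro borel_integrable_compact) auto
    show "AE x in lborel. (\<lambda>n. q n x) \<longlonglongrightarrow> grad F x \<bullet> e"
    proof (rule AE_I2)
      fix x
      have "((\<lambda>s. s *\<^sub>R e + x) has_derivative (\<lambda>s. s *\<^sub>R e)) (at 0)"
        by (auto intro!: derivative_eq_intros)
      moreover have "(F has_derivative (\<lambda>h. h \<bullet> grad F x)) (at (0 *\<^sub>R e + x))"
        using C1_onD(1)[OF F, of x] by (simp add: gderiv_def)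
      ultimately have "((\<lambda>s. F (s *\<^sub>R e + x)) has_derivative (\<lambda>s. (s *\<^sub>R e) \<bullet> grad F x)) (at 0)"
        by (rule has_derivative_compose)
      then have "DERIV (\<lambda>s. F (s *\<^sub>R e + x)) 0 :> grad F x \<bullet> e"
        unfolding has_field_derivative_def
        by (rule has_derivative_eq_rhs) (simp add: fun_eq_iff inner_commute mult.commute)
      then have *: "((\<lambda>s. (F (s *\<^sub>R e + x) - F x) / s) \<longlongrightarrow> grad F x \<bullet> e) (at 0)"
        by (simp add: DERIV_def)
      have "filterlim t (at 0) sequentially"
      proof (rule filterlim_atI)
        show "t \<longlonglongrightarrow> 0" unfolding t_def[abs_def] by (rule LIMSEQ_inverse_real_of_nat)
        show "\<forall>\<^sub>F n in sequentially. t n \<noteq> 0" using t(1) by (intro always_eventually) (auto simp: less_le)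
      qed
      from filterlim_compose[OF * this] show "(\<lambda>n. q n x) \<longlonglongrightarrow> grad F x \<bullet> e"
        by (simp add: q_def)
    qed
    show "AE x in lborel. norm (q n x) \<le> indicator (cball 0 R) x *\<^sub>R (max L 0 * norm e)" for n
    proof (rule AE_I2)
      fix x
      show "norm (q n x) \<le> indicator (cball 0 R) x *\<^sub>R (max L 0 * norm e)"
      proof (cases "norm x \<le> R")
        case True
        have "\<bar>F (t n *\<^sub>R e + x) - F x\<bar> \<le> max L 0 * (t n * norm e)"
          using lip[of "t n *\<^sub>R e + x" x] t[of n] by simp
        then show ?thesis using True t[of n] by (simp add: q_def abs_divide divide_le_eq mult_ac)
      next
        case False
        have "norm x \<le> norm (t n *\<^sub>R e + x) + norm (t n *\<^sub>R e)"
          using norm_triangle_ineq4[of "t n *\<^sub>R e + x" "t n *\<^sub>R e"] by simp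
        also have "norm (t n *\<^sub>R e) \<le> norm e"
          using t[of n] by (simp add: mult_left_le_one_le)
        finally have "norm (t n *\<^sub>R e + x) > r" using False by (simp add: R_def)
        moreover have "norm x > r" using False norm_ge_zero[of e] unfolding R_def by linarith
        ultimately have "x \<notin> S" "t n *\<^sub>R e + x \<notin> S" using r by (meson not_less)+
        then show ?thesis using False out by (simp add: q_def)
      qed
    qed
  qed
  then show ?thesis by (simp only: q0 LIMSEQ_const_iff)
qed

text \<open>Nothing is known about \<open>u\<close> outside the exterior domain, but its product
  with \<open>\<phi>\<close> vanishes off a compact subset of that domain. The product is therefore
  C1 on the whole space, and its gradient integrates to zero.\<close>

lemma integration_by_parts_C1c:
  fixes u :: "'a::euclidean_space \<Rightarrow> real"
  assumes u: "C1_on ext_ball u" and \<phi>: "\<phi> \<in> C1c"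
  shows "(LINT x|ext_leb. u x *\<^sub>R grad \<phi> x) = - (LINT x|ext_leb. \<phi> x *\<^sub>R grad u x)"
proof -
  obtain S where S: "C1_on UNIV \<phi>" "compact S" "S \<subseteq> ext_ball" "\<And>x. x \<notin> S \<Longrightarrow> \<phi> x = 0"
    "\<And>x. x \<notin> S \<Longrightarrow> grad \<phi> x = 0"
    by (rule C1cE[OF \<phi>], rule that)
  define F where "F x = u x * \<phi> x" for x
  define G where "G x = (if x \<in> ext_ball then u x *\<^sub>R grad \<phi> x + \<phi> x *\<^sub>R grad u x else 0)" for x
  have G0: "G x = 0" if "x \<notin> S" for x using S(4,5) that by (simp add: G_def)
  have F0: "F x = 0" if "x \<notin> S" for x using S(4) that by (simp add: F_def)
  have clS: "closed S" using S(2) by (rule compact_imp_closed)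
  have GF: "GDERIV F x :> G x" for x
  proof (cases "x \<in> S")
    case True
    then have x: "x \<in> ext_ball" using S(3) by auto
    then have "GDERIV F x :> u x *\<^sub>R grad \<phi> x + \<phi> x *\<^sub>R grad u x"
      unfolding F_def[abs_def] by (intro GDERIV_mult[OF C1_onD(1)[OF u x] C1_onD(1)[OF S(1)]]) simp
    then show ?thesis using x by (simp add: G_def)
  next
    case False
    then show ?thesis using grad_eq_0_outside(1)[OF clS F0 False] G0 by simp
  qed
  have cu: "continuous_on ext_ball u" "continuous_on ext_ball (grad u)" using C1_onD[OF u] by auto
  have cp: "continuous_on ext_ball \<phi>" "continuous_on ext_ball (grad \<phi>)"
    using continuous_on_subset C1_onD(2,3)[OF S(1)] by blast+
  have "continuous_on ext_ball (\<lambda>x. u x *\<^sub>R grad \<phi> x + \<phi> x *\<^sub>R grad u x)"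
    using cu cp by (intro continuous_intros)
  then have "continuous_on ext_ball G"
    by (rule continuous_on_eq) (simp add: G_def)
  moreover have "continuous_on (- S) G"
    using continuous_on_const by (rule continuous_on_eq) (simp add: G0)
  \<comment> \<open>The two open sets \<open>ext_ball\<close> and \<open>- S\<close> cover the
    space, which glues the local continuity statements.\<close>
  ultimately have "continuous_on (ext_ball \<union> - S) G"
    using open_ext_ball clS by (intro continuous_on_open_Un) auto
  moreover have "ext_ball \<union> - S = UNIV" using S(3) by auto
  ultimately have contG: "continuous_on UNIV G" by simp
  have C1F: "C1_on UNIV F" using GF contG by (rule C1_onI)
  have gradF: "grad F = G" using grad_eqI[OF GF] by auto
  have i1: "integrable ext_leb (\<lambda>x. u x *\<^sub>R grad \<phi> x)"
    by (rule integrable_mult_compact'[OF continuous_on_L1loc[OF cu(1)] S(2,3) cp(2)]) (rule S(5))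
  have i2: "integrable ext_leb (\<lambda>x. \<phi> x *\<^sub>R grad u x)"
    by (rule integrable_mult_compact[OF continuous_on_L1loc[OF cu(2)] S(2,3) cp(1)]) (rule S(4))
  have Gm: "G \<in> borel_measurable lborel" using contG by (simp add: borel_measurable_continuous_onI)
  have "indicator ext_ball x *\<^sub>R (u x *\<^sub>R grad \<phi> x + \<phi> x *\<^sub>R grad u x) = G x" for x
    by (simp add: G_def indicator_def)
  then have Gint: "integrable lebesgue G"
    and GL: "(LINT x|ext_leb. u x *\<^sub>R grad \<phi> x + \<phi> x *\<^sub>R grad u x) = (LINT x|lebesgue. G x)"
    using integrable_restrict_space[of ext_ball lebesgue "\<lambda>x. u x *\<^sub>R grad \<phi> x + \<phi> x *\<^sub>R grad u x"]
      integral_restrict_space[of ext_ball lebesgue "\<lambda>x. u x *\<^sub>R grad \<phi> x + \<phi> x *\<^sub>R grad u x"]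
      Bochner_Integration.integrable_add[OF i1 i2] by simp_all
  have "(LINT x|lebesgue. G x) = 0"
  \<comment> \<open>\<open>LINT_grad_eq_0\<close> treats one direction at a time over
    \<open>lborel\<close>. As \<open>G\<close> is Borel measurable, its components have the same
    integrals over the completed measure.\<close>
  proof (rule euclidean_eqI)
    fix e :: 'a
    have "(LINT x|lebesgue. G x) \<bullet> e = (LINT x|lebesgue. G x \<bullet> e)"
      using Gint by (intro integral_inner_left[symmetric])
    also have "\<dots> = (LINT x|lborel. G x \<bullet> e)"
      by (rule integral_completion) (use Gm in measurable)
    also have "\<dots> = 0"
      using LINT_grad_eq_0[OF C1F S(2) F0, of e] by (simp add: gradF)
    finally show "(LINT x|lebesgue. G x) \<bullet> e = 0 \<bullet> e" by simp
  qed
  then show ?thesis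
    using GL Bochner_Integration.integral_add[OF i1 i2] by (simp add: add_eq_0_iff2)
qed

lemma is_weak_grad_C1:
  assumes "C1_on ext_ball u"
  shows "is_weak_grad u (grad u)"
  unfolding is_weak_grad_def
  using continuous_on_L1loc[OF C1_onD(3)[OF assms]] continuous_on_L1loc[OF C1_onD(2)[OF assms]]
    integration_by_parts_C1c[OF assms] by simp

lemma integrable_weak_grad_test:
  assumes g: "is_weak_grad u g" and \<phi>: "\<phi> \<in> C1c"
  shows "integrable ext_leb (\<lambda>x. u x *\<^sub>R grad \<phi> x)" "integrable ext_leb (\<lambda>x. \<phi> x *\<^sub>R g x)"
proof -
  obtain S where S: "C1_on UNIV \<phi>" "compact S" "S \<subseteq> ext_ball" "\<And>x. x \<notin> S \<Longrightarrow> \<phi> x = 0"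
    "\<And>x. x \<notin> S \<Longrightarrow> grad \<phi> x = 0"
    by (rule C1cE[OF \<phi>], rule that)
  have c: "continuous_on ext_ball \<phi>" "continuous_on ext_ball (grad \<phi>)"
    using continuous_on_subset C1_onD(2,3)[OF S(1)] by blast+
  show "integrable ext_leb (\<lambda>x. u x *\<^sub>R grad \<phi> x)"
    using g S(5) by (intro integrable_mult_compact'[OF _ S(2,3) c(2)]) (auto simp: is_weak_grad_def)
  show "integrable ext_leb (\<lambda>x. \<phi> x *\<^sub>R g x)"
    using g S(4) by (intro integrable_mult_compact[OF _ S(2,3) c(1)]) (auto simp: is_weak_grad_def)
qed

lemma integral_lincomb:
  fixes f g :: "'a \<Rightarrow> 'b::{banach, second_countable_topology}"
  assumes "integrable M f" "integrable M g"
  shows "(LINT x|M. a *\<^sub>R f x + b *\<^sub>R g x) = a *\<^sub>R integral\<^sup>L M f + b *\<^sub>R integral\<^sup>L M g"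
  using assms by (subst Bochner_Integration.integral_add) auto

lemma is_weak_grad_lincomb:
  assumes u: "is_weak_grad u gu" and v: "is_weak_grad v gv"
  shows "is_weak_grad (\<lambda>x. a * u x + b * v x) (\<lambda>x. a *\<^sub>R gu x + b *\<^sub>R gv x)"
proof -
  have "(LINT x|ext_leb. (a * u x + b * v x) *\<^sub>R grad \<phi> x)
      = - (LINT x|ext_leb. \<phi> x *\<^sub>R (a *\<^sub>R gu x + b *\<^sub>R gv x))" if \<phi>: "\<phi> \<in> C1c" for \<phi>
  proof -
    note iu = integrable_weak_grad_test[OF u \<phi>] and iv = integrable_weak_grad_test[OF v \<phi>]
    have "(LINT x|ext_leb. (a * u x + b * v x) *\<^sub>R grad \<phi> x)
        = (LINT x|ext_leb. a *\<^sub>R (u x *\<^sub>R grad \<phi> x) + b *\<^sub>R (v x *\<^sub>R grad \<phi> x))"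
      by (simp add: scaleR_add_left)
    also have "\<dots> = a *\<^sub>R (LINT x|ext_leb. u x *\<^sub>R grad \<phi> x) + b *\<^sub>R (LINT x|ext_leb. v x *\<^sub>R grad \<phi> x)"
      by (rule integral_lincomb[OF iu(1) iv(1)])
    also have "\<dots> = - (a *\<^sub>R (LINT x|ext_leb. \<phi> x *\<^sub>R gu x) + b *\<^sub>R (LINT x|ext_leb. \<phi> x *\<^sub>R gv x))"
      using u v \<phi> by (simp add: is_weak_grad_def)
    also have "a *\<^sub>R (LINT x|ext_leb. \<phi> x *\<^sub>R gu x) + b *\<^sub>R (LINT x|ext_leb. \<phi> x *\<^sub>R gv x)
        = (LINT x|ext_leb. a *\<^sub>R (\<phi> x *\<^sub>R gu x) + b *\<^sub>R (\<phi> x *\<^sub>R gv x))"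
      by (rule integral_lincomb[OF iu(2) iv(2), symmetric])
    also have "\<dots> = (LINT x|ext_leb. \<phi> x *\<^sub>R (a *\<^sub>R gu x + b *\<^sub>R gv x))"
      by (simp add: scaleR_add_right mult.commute)
    finally show ?thesis .
  qed
  then show ?thesis
    using u v L1loc_lincomb[of u v a b] L1loc_lincomb[of gu gv a b] unfolding is_weak_grad_def by simp
qed

lemma is_weak_grad_wgrad: "is_weak_grad u g \<Longrightarrow> is_weak_grad u (wgrad u)"
  unfolding wgrad_def by (rule someI[of "is_weak_grad u"])

text \<open>The difference of two weak gradients integrates to zero against every test function.
  This makes the arbitrary choice in \<open>wgrad\<close> harmless under integrals.\<close>

lemma is_weak_grad_unique:
  assumes "is_weak_grad u g" "is_weak_grad u g'"
  shows "AE x in ext_leb. g x = g' x"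
proof -
  have "AE x in ext_leb. 1 *\<^sub>R g x + (- 1) *\<^sub>R g' x = 0"
  proof (rule L1loc_eq_0_AE)
    show "L1loc (\<lambda>x. 1 *\<^sub>R g x + (- 1) *\<^sub>R g' x)"
      using assms by (intro L1loc_lincomb) (auto simp: is_weak_grad_def)
    fix \<phi> :: "'a \<Rightarrow> real" assume \<phi>: "\<phi> \<in> C1c"
    have "(LINT x|ext_leb. \<phi> x *\<^sub>R g x) = (LINT x|ext_leb. \<phi> x *\<^sub>R g' x)"
      using assms \<phi> unfolding is_weak_grad_def by (metis neg_equal_iff_equal)
    then show "(LINT x|ext_leb. \<phi> x *\<^sub>R (1 *\<^sub>R g x + (- 1) *\<^sub>R g' x)) = 0"
      using integrable_weak_grad_test(2)[OF assms(1) \<phi>] integrable_weak_grad_test(2)[OF assms(2) \<phi>]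
      by (simp add: scaleR_diff_right)
  qed
  then show ?thesis by simp
qed

lemma wgrad_AE_eq:
  assumes "is_weak_grad u g"
  shows "AE x in ext_leb. wgrad u x = g x"
  by (rule is_weak_grad_unique[OF is_weak_grad_wgrad[OF assms] assms])

lemma weak_grad_measurable: "is_weak_grad u g \<Longrightarrow> g \<in> borel_measurable ext_leb"
  by (simp add: is_weak_grad_def L1loc_measurable)

subsection \<open>The space D01p\<close>

text \<open>A sum of two norms is at most twice the larger one, and the power of a maximum is at
  most the sum of the powers. The constant \<open>2 powr p\<close> is crude but valid for every
  \<open>p > 0\<close>.\<close>

lemma norm_lincomb_powr_le:
  fixes x y :: "'a::real_normed_vector"
  assumes "p > 0"
  shows "norm (a *\<^sub>R x + b *\<^sub>R y) powr p
    \<le> 2 powr p * (\<bar>a\<bar> powr p * norm x powr p + \<bar>b\<bar> powr p * norm y powr p)"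
proof -
  define s t where "s = norm (a *\<^sub>R x)" and "t = norm (b *\<^sub>R y)"
  have st: "0 \<le> s" "0 \<le> t" by (simp_all add: s_def t_def)
  have "norm (a *\<^sub>R x + b *\<^sub>R y) \<le> 2 * max s t"
    using norm_triangle_ineq[of "a *\<^sub>R x" "b *\<^sub>R y"] by (simp add: s_def t_def)
  then have "norm (a *\<^sub>R x + b *\<^sub>R y) powr p \<le> (2 * max s t) powr p"
    using assms by (intro powr_mono2) auto
  also have "\<dots> = 2 powr p * max s t powr p"
    using st by (simp add: powr_mult)
  also have "\<dots> \<le> 2 powr p * (s powr p + t powr p)"
    by (intro mult_left_mono) (auto simp: max_def)
  finally show ?thesis by (simp add: s_def t_def powr_mult)
qed

lemma integrable_lincomb_powr:
  fixes f g :: "'a \<Rightarrow> 'b::euclidean_space"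
  assumes "p > 0" and f: "f \<in> borel_measurable M" "integrable M (\<lambda>x. norm (f x) powr p)"
    and g: "g \<in> borel_measurable M" "integrable M (\<lambda>x. norm (g x) powr p)"
  shows "integrable M (\<lambda>x. norm (a *\<^sub>R f x + b *\<^sub>R g x) powr p)"
proof (rule Bochner_Integration.integrable_bound)
  show "integrable M (\<lambda>x. 2 powr p * (\<bar>a\<bar> powr p * norm (f x) powr p + \<bar>b\<bar> powr p * norm (g x) powr p))"
    using f g by (intro integrable_mult_right Bochner_Integration.integrable_add) auto
  show "(\<lambda>x. norm (a *\<^sub>R f x + b *\<^sub>R g x) powr p) \<in> borel_measurable M"
    using f(1) g(1) by measurable
  show "AE x in M. norm (norm (a *\<^sub>R f x + b *\<^sub>R g x) powr p)
      \<le> norm (2 powr p * (\<bar>a\<bar> powr p * norm (f x) powr p + \<bar>b\<bar> powr p * norm (g x) powr p))"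
  proof (rule AE_I2)
    fix x
    show "norm (norm (a *\<^sub>R f x + b *\<^sub>R g x) powr p)
      \<le> norm (2 powr p * (\<bar>a\<bar> powr p * norm (f x) powr p + \<bar>b\<bar> powr p * norm (g x) powr p))"
      using norm_lincomb_powr_le[OF assms(1), of a "f x" b "g x"] by simp
  qed
qed

lemma integrable_continuous_compact:
  fixes F :: "'a::euclidean_space \<Rightarrow> real"
  assumes F: "F \<in> borel_measurable ext_leb" and S: "compact S" "S \<subseteq> ext_ball"
    and c: "continuous_on S F" and out: "\<And>x. x \<in> ext_ball \<Longrightarrow> x \<notin> S \<Longrightarrow> F x = 0"
  shows "integrable ext_leb F"
proof -
  have "bounded (F ` S)"
    using c S(1) by (intro compact_imp_bounded compact_continuous_image)
  then obtain C where C: "\<And>x. x \<in> S \<Longrightarrow> norm (F x) \<le> C" by (auto simp: bounded_iff)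
  have "L1loc (\<lambda>x::'a. 1::real)" by (rule continuous_on_L1loc) (rule continuous_on_const)
  then show ?thesis
    by (rule integrable_dominated_compact[OF _ S F, where C = C]) (use C out in auto)
qed

lemma C1c_C1_on: "\<phi> \<in> C1c \<Longrightarrow> C1_on S \<phi>"
  using C1_on_subset[of UNIV \<phi> S] by (simp add: C1c_def)

lemma is_weak_grad_C1c: "\<phi> \<in> C1c \<Longrightarrow> is_weak_grad \<phi> (grad \<phi>)"
  by (rule is_weak_grad_C1[OF C1c_C1_on])

lemma C1c_grad_powr_integrable:
  assumes \<phi>: "\<phi> \<in> C1c" and "p > 0"
  shows "integrable ext_leb (\<lambda>x. norm (grad \<phi> x) powr p)"
proof -
  obtain S where S: "C1_on UNIV \<phi>" "compact S" "S \<subseteq> ext_ball" "\<And>x. x \<notin> S \<Longrightarrow> \<phi> x = 0"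
    "\<And>x. x \<notin> S \<Longrightarrow> grad \<phi> x = 0"
    by (rule C1cE[OF \<phi>], rule that)
  have c: "continuous_on T (\<lambda>x. norm (grad \<phi> x) powr p)" for T
    using C1_onD(2)[OF C1c_C1_on[OF \<phi>, of T]] \<open>p > 0\<close>
    by (intro continuous_on_powr' continuous_on_norm continuous_on_const) auto
  show ?thesis
    using S(5) by (intro integrable_continuous_compact[OF continuous_ext_measurable[OF c] S(2,3) c]) auto
qed

text \<open>The definition of \<open>D01p\<close> refers to the chosen \<open>wgrad\<close>; almost
  everywhere uniqueness lets an explicit weak gradient take its place.\<close>

lemma D01pI:
  assumes g: "is_weak_grad u g" and int: "integrable ext_leb (\<lambda>x. norm (g x) powr p)"
    and \<phi>: "\<And>n. \<phi> n \<in> C1c"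
    and lim: "(\<lambda>n. LINT x|ext_leb. norm (grad (\<phi> n) x - g x) powr p) \<longlonglongrightarrow> 0"
    and loc: "\<And>S. compact S \<Longrightarrow> S \<subseteq> ext_ball \<Longrightarrow> (\<lambda>n. LINT x|lebesgue_on S. \<bar>\<phi> n x - u x\<bar>) \<longlonglongrightarrow> 0"
  shows "u \<in> D01p p"
proof -
  note ae = wgrad_AE_eq[OF g]
  have m: "g \<in> borel_measurable ext_leb" "wgrad u \<in> borel_measurable ext_leb"
    using weak_grad_measurable[OF g] weak_grad_measurable[OF is_weak_grad_wgrad[OF g]] .
  have m\<phi>: "grad (\<phi> n) \<in> borel_measurable ext_leb" for n
    by (rule weak_grad_measurable[OF is_weak_grad_C1c[OF \<phi>]])
  have "integrable ext_leb (\<lambda>x. norm (wgrad u x) powr p) \<longleftrightarrow> integrable ext_leb (\<lambda>x. norm (g x) powr p)"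
    by (rule integrable_cong_AE) (use m ae in auto)
  moreover have "(LINT x|ext_leb. norm (grad (\<phi> n) x - wgrad u x) powr p)
      = (LINT x|ext_leb. norm (grad (\<phi> n) x - g x) powr p)" for n
    by (rule integral_cong_AE) (use m m\<phi>[of n] ae in auto)
  ultimately show ?thesis
    unfolding D01p_def mem_Collect_eq
    using g int \<phi> lim loc by (intro conjI exI[of _ \<phi>] exI[of _ g]) (auto simp: is_weak_grad_def)
qed

lemma D01p_weak_grad: "u \<in> D01p p \<Longrightarrow> is_weak_grad u (wgrad u)"
  unfolding D01p_def using is_weak_grad_wgrad by blast

lemma C1c_subset_D01p:
  assumes "\<phi> \<in> C1c" "p > 0"
  shows "\<phi> \<in> D01p p"
  by (rule D01pI[OF is_weak_grad_C1c[OF assms(1)] C1c_grad_powr_integrable[OF assms], of "\<lambda>_. \<phi>"])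
     (simp_all add: assms)

lemma L1loc_integrable: "L1loc f \<Longrightarrow> compact S \<Longrightarrow> S \<subseteq> ext_ball \<Longrightarrow> integrable (lebesgue_on S) f"
  unfolding L1loc_def by (meson absolutely_integrable_imp_integrable lmeasurable_compact fmeasurableD)

text \<open>The same combination of the approximating sequences works:
  \<open>norm_lincomb_powr_le\<close> controls the gradients and the triangle inequality the local
  L1 distance. Putting one coefficient to 0 gives scalar multiples.\<close>

lemma D01p_lincomb:
  fixes u v :: "'a::euclidean_space \<Rightarrow> real"
  assumes u: "u \<in> D01p p" and v: "v \<in> D01p p" and p: "p > 0"
  shows "(\<lambda>x. a * u x + b * v x) \<in> D01p p"
proof -
  obtain \<phi> where \<phi>: "\<And>n. \<phi> n \<in> C1c"
    "(\<lambda>n. LINT x|ext_leb. norm (grad (\<phi> n) x - wgrad u x) powr p) \<longlonglongrightarrow> 0"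
    "\<And>S. compact S \<Longrightarrow> S \<subseteq> ext_ball \<Longrightarrow> (\<lambda>n. LINT x|lebesgue_on S. \<bar>\<phi> n x - u x\<bar>) \<longlonglongrightarrow> 0"
    using u unfolding D01p_def by blast
  obtain \<psi> where \<psi>: "\<And>n. \<psi> n \<in> C1c"
    "(\<lambda>n. LINT x|ext_leb. norm (grad (\<psi> n) x - wgrad v x) powr p) \<longlonglongrightarrow> 0"
    "\<And>S. compact S \<Longrightarrow> S \<subseteq> ext_ball \<Longrightarrow> (\<lambda>n. LINT x|lebesgue_on S. \<bar>\<psi> n x - v x\<bar>) \<longlonglongrightarrow> 0"
    using v unfolding D01p_def by blast
  note wu = D01p_weak_grad[OF u] and wv = D01p_weak_grad[OF v]
  note mu = weak_grad_measurable[OF wu] and mv = weak_grad_measurable[OF wv]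
  have iu: "integrable ext_leb (\<lambda>x. norm (wgrad u x) powr p)"
    and iv: "integrable ext_leb (\<lambda>x. norm (wgrad v x) powr p)"
    using u v unfolding D01p_def by auto
  have diff: "integrable ext_leb (\<lambda>x. norm (grad \<eta> x - g x) powr p)" "(\<lambda>x. grad \<eta> x - g x) \<in> borel_measurable ext_leb"
    if "\<eta> \<in> C1c" "g \<in> borel_measurable ext_leb" "integrable ext_leb (\<lambda>x. norm (g x) powr p)" for \<eta> and g :: "'a \<Rightarrow> 'a"
  proof -
    have m: "grad \<eta> \<in> borel_measurable ext_leb"
      by (rule weak_grad_measurable[OF is_weak_grad_C1c[OF that(1)]])
    show "integrable ext_leb (\<lambda>x. norm (grad \<eta> x - g x) powr p)"
      using integrable_lincomb_powr[OF p m C1c_grad_powr_integrable[OF that(1) p] that(2,3), of 1 "-1"] by simp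
    show "(\<lambda>x. grad \<eta> x - g x) \<in> borel_measurable ext_leb" using m that(2) by measurable
  qed
  have grad: "grad (\<lambda>x. a * \<phi> n x + b * \<psi> n x) x = a *\<^sub>R grad (\<phi> n) x + b *\<^sub>R grad (\<psi> n) x" for n x
    using C1_onD(1)[OF C1c_C1_on[OF \<phi>(1)], of x UNIV] C1_onD(1)[OF C1c_C1_on[OF \<psi>(1)], of x UNIV]
    by (intro grad_eqI GDERIV_lincomb) auto
  show ?thesis
  proof (rule D01pI[OF is_weak_grad_lincomb[OF wu wv], of _ _ _ "\<lambda>n x. a * \<phi> n x + b * \<psi> n x"])
    show "integrable ext_leb (\<lambda>x. norm (a *\<^sub>R wgrad u x + b *\<^sub>R wgrad v x) powr p)"
      by (rule integrable_lincomb_powr[OF p mu iu mv iv])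
    show "(\<lambda>x. a * \<phi> n x + b * \<psi> n x) \<in> C1c" for n
      by (rule C1c_lincomb[OF \<phi>(1) \<psi>(1)])
    show "(\<lambda>n. LINT x|ext_leb. norm (grad (\<lambda>x. a * \<phi> n x + b * \<psi> n x) x
        - (a *\<^sub>R wgrad u x + b *\<^sub>R wgrad v x)) powr p) \<longlonglongrightarrow> 0"
    proof (rule tendsto_sandwich[OF _ _ tendsto_const])
      let ?I = "\<lambda>n. LINT x|ext_leb. norm (grad (\<phi> n) x - wgrad u x) powr p"
      let ?J = "\<lambda>n. LINT x|ext_leb. norm (grad (\<psi> n) x - wgrad v x) powr p"
      show "(\<lambda>n. 2 powr p * (\<bar>a\<bar> powr p * ?I n + \<bar>b\<bar> powr p * ?J n)) \<longlonglongrightarrow> 0"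
        using \<phi>(2) \<psi>(2) by (auto intro!: tendsto_eq_intros)
      show "\<forall>\<^sub>F n in sequentially. (LINT x|ext_leb. norm (grad (\<lambda>x. a * \<phi> n x + b * \<psi> n x) x
        - (a *\<^sub>R wgrad u x + b *\<^sub>R wgrad v x)) powr p) \<le> 2 powr p * (\<bar>a\<bar> powr p * ?I n + \<bar>b\<bar> powr p * ?J n)"
      proof (intro always_eventually allI)
        fix n
        note du = diff[OF \<phi>(1)[of n] mu iu] and dv = diff[OF \<psi>(1)[of n] mv iv]
        have "(LINT x|ext_leb. norm (grad (\<lambda>x. a * \<phi> n x + b * \<psi> n x) x
              - (a *\<^sub>R wgrad u x + b *\<^sub>R wgrad v x)) powr p)
            = (LINT x|ext_leb. norm (a *\<^sub>R (grad (\<phi> n) x - wgrad u x) + b *\<^sub>R (grad (\<psi> n) x - wgrad v x)) powr p)"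
          by (simp add: grad algebra_simps)
        also have "\<dots> \<le> (LINT x|ext_leb. 2 powr p * (\<bar>a\<bar> powr p * norm (grad (\<phi> n) x - wgrad u x) powr p
            + \<bar>b\<bar> powr p * norm (grad (\<psi> n) x - wgrad v x) powr p))"
        proof (rule integral_mono)
          show "integrable ext_leb (\<lambda>x. norm (a *\<^sub>R (grad (\<phi> n) x - wgrad u x) + b *\<^sub>R (grad (\<psi> n) x - wgrad v x)) powr p)"
            by (rule integrable_lincomb_powr[OF p du(2) du(1) dv(2) dv(1)])
          show "integrable ext_leb (\<lambda>x. 2 powr p * (\<bar>a\<bar> powr p * norm (grad (\<phi> n) x - wgrad u x) powr p
            + \<bar>b\<bar> powr p * norm (grad (\<psi> n) x - wgrad v x) powr p))"
            using du(1) dv(1) by (intro integrable_mult_right Bochner_Integration.integrable_add) auto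
        qed (rule norm_lincomb_powr_le[OF p])
        also have "\<dots> = 2 powr p * (\<bar>a\<bar> powr p * ?I n + \<bar>b\<bar> powr p * ?J n)"
          using integral_lincomb[OF du(1) dv(1), of "\<bar>a\<bar> powr p" "\<bar>b\<bar> powr p"] by simp
        finally show "(LINT x|ext_leb. norm (grad (\<lambda>x. a * \<phi> n x + b * \<psi> n x) x
          - (a *\<^sub>R wgrad u x + b *\<^sub>R wgrad v x)) powr p) \<le> 2 powr p * (\<bar>a\<bar> powr p * ?I n + \<bar>b\<bar> powr p * ?J n)" .
      qed
    qed simp
    fix S :: "'a set" assume S: "compact S" "S \<subseteq> ext_ball"
    have lu: "L1loc u" and lv: "L1loc v" using wu wv by (auto simp: is_weak_grad_def)
    have l\<phi>: "L1loc (\<phi> n)" "L1loc (\<psi> n)" for n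
      using is_weak_grad_C1c[OF \<phi>(1)] is_weak_grad_C1c[OF \<psi>(1)] by (auto simp: is_weak_grad_def)
    show "(\<lambda>n. LINT x|lebesgue_on S. \<bar>a * \<phi> n x + b * \<psi> n x - (a * u x + b * v x)\<bar>) \<longlonglongrightarrow> 0"
    proof (rule tendsto_sandwich[OF _ _ tendsto_const])
      let ?I = "\<lambda>n. LINT x|lebesgue_on S. \<bar>\<phi> n x - u x\<bar>"
      let ?J = "\<lambda>n. LINT x|lebesgue_on S. \<bar>\<psi> n x - v x\<bar>"
      show "(\<lambda>n. \<bar>a\<bar> * ?I n + \<bar>b\<bar> * ?J n) \<longlonglongrightarrow> 0"
        using \<phi>(3)[OF S] \<psi>(3)[OF S] by (auto intro!: tendsto_eq_intros)
      show "\<forall>\<^sub>F n in sequentially. (LINT x|lebesgue_on S. \<bar>a * \<phi> n x + b * \<psi> n x - (a * u x + b * v x)\<bar>)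
          \<le> \<bar>a\<bar> * ?I n + \<bar>b\<bar> * ?J n"
      proof (intro always_eventually allI)
        fix n
        note iu = L1loc_integrable[OF lu S] and iv = L1loc_integrable[OF lv S]
          and i\<phi> = L1loc_integrable[OF l\<phi>(1) S, of n] and i\<psi> = L1loc_integrable[OF l\<phi>(2) S, of n]
        have d: "integrable (lebesgue_on S) (\<lambda>x. \<bar>\<phi> n x - u x\<bar>)" "integrable (lebesgue_on S) (\<lambda>x. \<bar>\<psi> n x - v x\<bar>)"
          using iu iv i\<phi> i\<psi> by auto
        have "(LINT x|lebesgue_on S. \<bar>a * \<phi> n x + b * \<psi> n x - (a * u x + b * v x)\<bar>)
          \<le> (LINT x|lebesgue_on S. \<bar>a\<bar> * \<bar>\<phi> n x - u x\<bar> + \<bar>b\<bar> * \<bar>\<psi> n x - v x\<bar>)"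
        proof (rule integral_mono)
          show "integrable (lebesgue_on S) (\<lambda>x. \<bar>a * \<phi> n x + b * \<psi> n x - (a * u x + b * v x)\<bar>)"
            using iu iv i\<phi> i\<psi> by (intro integrable_abs Bochner_Integration.integrable_diff
                Bochner_Integration.integrable_add integrable_mult_right) auto
          show "integrable (lebesgue_on S) (\<lambda>x. \<bar>a\<bar> * \<bar>\<phi> n x - u x\<bar> + \<bar>b\<bar> * \<bar>\<psi> n x - v x\<bar>)"
            using d by (intro Bochner_Integration.integrable_add integrable_mult_right) auto
          fix x
          have "a * \<phi> n x + b * \<psi> n x - (a * u x + b * v x) = a * (\<phi> n x - u x) + b * (\<psi> n x - v x)"
            by (simp add: algebra_simps)
          then show "\<bar>a * \<phi> n x + b * \<psi> n x - (a * u x + b * v x)\<bar> \<le> \<bar>a\<bar> * \<bar>\<phi> n x - u x\<bar> + \<bar>b\<bar> * \<bar>\<psi> n x - v x\<bar>"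
            using abs_triangle_ineq[of "a * (\<phi> n x - u x)" "b * (\<psi> n x - v x)"] by (simp only: abs_mult)
        qed
        also have "\<dots> = \<bar>a\<bar> * ?I n + \<bar>b\<bar> * ?J n"
          using integral_lincomb[OF d, of "\<bar>a\<bar>" "\<bar>b\<bar>"] by simp
        finally show "(LINT x|lebesgue_on S. \<bar>a * \<phi> n x + b * \<psi> n x - (a * u x + b * v x)\<bar>)
          \<le> \<bar>a\<bar> * ?I n + \<bar>b\<bar> * ?J n" .
      qed
    qed simp
  qed
qed

section \<open>The two homogeneous terms of the energy and the variational inequality\<close>

definition dirichlet :: "real \<Rightarrow> ('a::euclidean_space \<Rightarrow> real) \<Rightarrow> real"
  where "dirichlet p u = (LINT x|ext_leb. norm (wgrad u x) powr p)"

definition potential :: "real \<Rightarrow> ('a::euclidean_space \<Rightarrow> real) \<Rightarrow> ('a \<Rightarrow> real) \<Rightarrow> real"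
  where "potential p K u = (LINT x|ext_leb. K x * \<bar>u x\<bar> powr p)"

lemma dirichlet_eq:
  assumes "is_weak_grad u g"
  shows "dirichlet p u = (LINT x|ext_leb. norm (g x) powr p)"
  unfolding dirichlet_def
proof (rule integral_cong_AE)
  show "AE x in ext_leb. norm (wgrad u x) powr p = norm (g x) powr p"
    using wgrad_AE_eq[OF assms] by eventually_elim simp
qed (use weak_grad_measurable[OF assms] weak_grad_measurable[OF is_weak_grad_wgrad[OF assms]] in measurable)

lemma dirichlet_nonneg: "0 \<le> dirichlet p u"
  unfolding dirichlet_def by (rule Bochner_Integration.integral_nonneg) simp

lemma dirichlet_scale:
  assumes "u \<in> D01p p"
  shows "dirichlet p (\<lambda>x. c * u x) = \<bar>c\<bar> powr p * dirichlet p u"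
proof -
  have "is_weak_grad (\<lambda>x. c * u x) (\<lambda>x. c *\<^sub>R wgrad u x)"
    using is_weak_grad_lincomb[OF D01p_weak_grad[OF assms] D01p_weak_grad[OF assms], of c 0] by simp
  from dirichlet_eq[OF this, of p] show ?thesis
    by (simp add: powr_mult dirichlet_def)
qed

lemma potential_scale: "potential p K (\<lambda>x. c * u x) = \<bar>c\<bar> powr p * potential p K u"
proof -
  have "K x * \<bar>c * u x\<bar> powr p = \<bar>c\<bar> powr p * (K x * \<bar>u x\<bar> powr p)" for x
    by (simp add: abs_mult powr_mult)
  \<comment> \<open>Pulling a constant out needs no integrability, so the identity also covers the
    default value 0 of the integral.\<close>
  then show ?thesis unfolding potential_def by (simp only: integral_mult_right_zero)
qed

text \<open>Scaling \<open>u\<close> to potential 1 turns it into a competitor for the infimum. If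
  the potential is not positive, which includes the default value 0 for a non-integrable integrand,
  \<open>0 \<le> lambda1 p K\<close> suffices.\<close>

lemma lambda1_potential_le:
  assumes u: "u \<in> D01p p" and p: "p > 0" and l: "0 \<le> lambda1 p K"
  shows "lambda1 p K * potential p K u \<le> dirichlet p u"
proof (cases "potential p K u > 0")
  case False
  then have "lambda1 p K * potential p K u \<le> 0" using l by (simp add: mult_nonneg_nonpos)
  then show ?thesis using dirichlet_nonneg[of p u] by linarith
next
  case True
  define c where "c = potential p K u powr (- (1 / p))"
  have cp: "\<bar>c\<bar> powr p = inverse (potential p K u)"
  proof -
    have "\<bar>c\<bar> powr p = potential p K u powr (- (1 / p) * p)"
      unfolding c_def by (simp only: powr_powr abs_of_nonneg powr_ge_zero)
    also have "- (1 / p) * p = - 1" using p by simp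
    finally show ?thesis using True by (simp only: powr_minus powr_one less_imp_le)
  qed
  let ?E = "{LINT x|ext_leb. norm (wgrad u x) powr p | u. u \<in> D01p p \<and> (LINT x|ext_leb. K x * \<bar>u x\<bar> powr p) = 1}"
  have "potential p K (\<lambda>x. c * u x) = 1" using True by (simp add: potential_scale cp)
  moreover have "(\<lambda>x. c * u x) \<in> D01p p" using D01p_lincomb[OF u u p, of c 0] by simp
  ultimately have "dirichlet p (\<lambda>x. c * u x) \<in> ?E" unfolding dirichlet_def potential_def by blast
  \<comment> \<open>On the reals, \<open>Inf\<close> is known to be a lower bound only for sets that
    are bounded below.\<close>
  moreover have "bdd_below ?E"
    by (rule bdd_belowI[of _ 0]) (auto intro!: Bochner_Integration.integral_nonneg)
  ultimately have "lambda1 p K \<le> dirichlet p (\<lambda>x. c * u x)" unfolding lambda1_def by (rule cInf_lower)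
  then show ?thesis using True by (simp add: dirichlet_scale[OF u] cp field_simps)
qed

subsection \<open>Second-order bounds\<close>

text \<open>This is weighted AM-GM for \<open>s\<close> and \<open>s0\<close>, multiplied by
  \<open>s0 powr (q - 1)\<close>. The value \<open>s = 0\<close> is treated separately; it arises
  when \<open>a + b = 0\<close> in \<open>norm_add_powr_le\<close>.\<close>

lemma powr_le_tangent:
  fixes s s0 q :: real
  assumes "0 < q" "q < 1" "0 < s0" "0 \<le> s"
  shows "s powr q \<le> s0 powr q + q * s0 powr (q - 1) * (s - s0)"
proof (cases "s = 0")
  case True
  have "s0 powr (q - 1) * s0 = s0 powr q" using assms(3) by (simp add: powr_diff)
  then have "s0 powr q + q * s0 powr (q - 1) * (s - s0) = (1 - q) * s0 powr q"
    using True by (simp add: algebra_simps)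
  also have "\<dots> \<ge> 0" using assms(2) by simp
  finally show ?thesis using True by simp
next
  case False
  have "s powr q * s0 powr (1 - q) \<le> q * s + (1 - q) * s0"
    using assms False by (intro Youngs_inequality_0) auto
  then have "s powr q * s0 powr (1 - q) * s0 powr (q - 1) \<le> (q * s + (1 - q) * s0) * s0 powr (q - 1)"
    by (rule mult_right_mono) simp
  moreover have "s0 powr (1 - q) * s0 powr (q - 1) = 1"
    using assms(3) by (simp add: powr_add[symmetric])
  moreover have "s0 powr (q - 1) * s0 = s0 powr q" using assms(3) by (simp add: powr_diff)
  ultimately show ?thesis by (simp add: algebra_simps)
qed

text \<open>Concavity of \<open>s \<mapsto> s powr (p / 2)\<close> at \<open>s = norm (a + b)\<^sup>2\<close>; no smallness of \<open>b\<close> is needed.\<close>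

lemma norm_add_powr_le:
  fixes a b :: "'a::real_inner"
  assumes "0 < p" "p < 2" "a \<noteq> 0"
  shows "norm (a + b) powr p
    \<le> norm a powr p + p * norm a powr (p - 2) * (a \<bullet> b) + p / 2 * norm a powr (p - 2) * (norm b)\<^sup>2"
proof -
  have sq: "((norm c)\<^sup>2) powr r = norm c powr (2 * r)" for c :: 'a and r
    by (cases "c = 0") (simp_all add: powr_powr flip: powr_numeral)
  have 1: "((norm (a + b))\<^sup>2) powr (p / 2) \<le> ((norm a)\<^sup>2) powr (p / 2)
      + p / 2 * ((norm a)\<^sup>2) powr (p / 2 - 1) * ((norm (a + b))\<^sup>2 - (norm a)\<^sup>2)"
    using assms by (intro powr_le_tangent) auto
  have 2: "2 * (p / 2 - 1) = p - 2" "2 * (p / 2) = p" by simp_all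
  \<comment> \<open>The squared norm expands exactly, so the tangent bound itself supplies both the
    linear and the quadratic term.\<close>
  have 3: "(norm (a + b))\<^sup>2 - (norm a)\<^sup>2 = 2 * (a \<bullet> b) + (norm b)\<^sup>2"
    by (simp add: power2_norm_eq_inner inner_add_left inner_add_right inner_commute)
  have "p / 2 * norm a powr (p - 2) * (2 * (a \<bullet> b) + (norm b)\<^sup>2)
      = p * norm a powr (p - 2) * (a \<bullet> b) + p / 2 * norm a powr (p - 2) * (norm b)\<^sup>2"
    by (simp add: field_simps)
  then show ?thesis using 1 unfolding sq 2 3 by linarith
qed

text \<open>The left side is the tangent at \<open>a\<close> of a convex function. For
  \<open>a + b > 0\<close> the bound is Young's inequality with weights \<open>1 / p\<close> and
  \<open>1 - 1 / p\<close>; otherwise the tangent is at most \<open>(1 - p) * a powr p\<close>,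
  hence not positive.\<close>

lemma abs_add_powr_ge:
  fixes a b :: real
  assumes "1 < p" "0 < a"
  shows "a powr p + p * a powr (p - 1) * b \<le> \<bar>a + b\<bar> powr p"
proof -
  have ap: "a powr (p - 1) * a = a powr p" using assms(2) by (simp add: powr_diff)
  show ?thesis
  proof (cases "a + b > 0")
    case True
    have "((a + b) powr p) powr (1 / p) * (a powr p) powr (1 - 1 / p)
        \<le> 1 / p * (a + b) powr p + (1 - 1 / p) * a powr p"
      using assms True by (intro Youngs_inequality_0) auto
    moreover have "((a + b) powr p) powr (1 / p) = a + b" using True assms by (simp add: powr_powr)
    moreover have "(a powr p) powr (1 - 1 / p) = a powr (p - 1)"
      using assms by (simp add: powr_powr algebra_simps)
    ultimately have "p * ((a + b) * a powr (p - 1)) \<le> p * (1 / p * (a + b) powr p + (1 - 1 / p) * a powr p)"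
      using assms by (intro mult_left_mono) auto
    then have "p * ((a + b) * a powr (p - 1)) \<le> (a + b) powr p + (p - 1) * a powr p"
      using assms by (simp add: algebra_simps)
    moreover have "p * ((a + b) * a powr (p - 1)) = p * a powr p + p * a powr (p - 1) * b"
      unfolding ap[symmetric] by (simp add: algebra_simps)
    moreover have "(p - 1) * a powr p = p * a powr p - a powr p" by (simp add: algebra_simps)
    moreover have "\<bar>a + b\<bar> = a + b" using True by simp
    ultimately show ?thesis by linarith
  next
    case False
    have "p * a powr (p - 1) * b \<le> p * a powr (p - 1) * (- a)"
      using assms False by (intro mult_left_mono) auto
    also have "\<dots> = - p * a powr p" using ap by simp
    finally have "a powr p + p * a powr (p - 1) * b \<le> (1 - p) * a powr p" by (simp add: algebra_simps)
    also have "\<dots> \<le> 0" using assms by (simp add: mult_nonpos_nonneg)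
    also have "0 \<le> \<bar>a + b\<bar> powr p" by simp
    finally show ?thesis .
  qed
qed

text \<open>The one-dimensional case of \<open>norm_add_powr_le\<close>. Together with
  \<open>abs_add_powr_ge\<close> it confines the remainder after the linear term between 0 and a
  quadratic.\<close>

lemma abs_add_powr_le:
  fixes a b :: real
  assumes "0 < p" "p < 2" "0 < a"
  shows "\<bar>a + b\<bar> powr p \<le> a powr p + p * a powr (p - 1) * b + p / 2 * a powr (p - 2) * b\<^sup>2"
proof -
  have "a powr (p - 1) = a powr ((p - 2) + 1)" by simp
  also have "\<dots> = a powr (p - 2) * a powr 1" by (rule powr_add)
  also have "a powr 1 = a" using assms(3) by simp
  finally have "a powr (p - 2) * a = a powr (p - 1)" by simp
  then have "p * a powr (p - 2) * (a * b) = p * a powr (p - 1) * b" by (simp add: mult.assoc[symmetric])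
  moreover have "\<bar>a + b\<bar> powr p \<le> a powr p + p * a powr (p - 2) * (a * b) + p / 2 * a powr (p - 2) * b\<^sup>2"
    using norm_add_powr_le[of p a b] assms by simp
  ultimately show ?thesis by (simp only:)
qed

lemma nonneg_quadratic_imp_linear_coeff_0:
  fixes A B :: real
  assumes "\<And>e. 0 \<le> A * e + B * e\<^sup>2"
  shows "A = 0"
proof (rule ccontr)
  assume A: "A \<noteq> 0"
  \<comment> \<open>With \<open>d > B\<close>, the point \<open>e = - A / d\<close> gives the value
    \<open>(A\<^sup>2 / d\<^sup>2) * (B - d)\<close>, which is negative.\<close>
  define d where "d = \<bar>B\<bar> + 1"
  have d: "d > 0" "B < d" by (auto simp: d_def)
  have "0 \<le> A * (- A / d) + B * (- A / d)\<^sup>2" by (rule assms)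
  also have "\<dots> = (A\<^sup>2 / d\<^sup>2) * (B - d)" using d by (simp add: field_simps power2_eq_square)
  also have "\<dots> < 0" using A d by (intro mult_pos_neg) auto
  finally show False by simp
qed

section \<open>Second-order bounds for the two terms of the energy\<close>

lemma C1c_continuous_on:
  assumes "\<phi> \<in> C1c"
  shows "continuous_on T \<phi>" "continuous_on T (grad \<phi>)"
  using C1_onD(2,3)[OF C1c_C1_on[OF assms]] by blast+

text \<open>\<open>norm (grad u x) powr (p - 2)\<close> is bounded on the support of \<open>grad \<phi>\<close>, a compact set without
  critical points of \<open>u\<close>.\<close>

lemma dirichlet_C1_le:
  fixes u :: "'a::euclidean_space \<Rightarrow> real"
  assumes p: "0 < p" "p < 2" and u: "u \<in> D01p p" "C1_on ext_ball u" and \<phi>: "\<phi> \<in> Y_space u"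
  obtains A B where "\<And>e. dirichlet p (\<lambda>x. u x + e * \<phi> x) \<le> dirichlet p u + A * e + B * e\<^sup>2"
proof -
  obtain U where U: "\<phi> \<in> C1c" "open U" "crit_set u \<subseteq> U" "\<phi> constant_on U"
    using \<phi> unfolding Y_space_def by auto
  obtain S where S: "C1_on UNIV \<phi>" "compact S" "S \<subseteq> ext_ball" "\<And>x. x \<notin> S \<Longrightarrow> \<phi> x = 0"
    "\<And>x. x \<notin> S \<Longrightarrow> grad \<phi> x = 0"
    by (rule C1cE[OF U(1)], rule that)
  have gU: "grad \<phi> x = 0" if "x \<in> U" for x
  proof -
    obtain c where c: "\<And>y. y \<in> U \<Longrightarrow> \<phi> y = c" using U(4) unfolding constant_on_def by auto
    have "((\<lambda>y. c) has_derivative (\<lambda>h. h \<bullet> 0)) (at x)" by simp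
    then have "(\<phi> has_derivative (\<lambda>h. h \<bullet> 0)) (at x)"
      by (rule has_derivative_transform_within_open[OF _ U(2) that]) (simp add: c)
    then show ?thesis by (intro grad_eqI) (simp add: gderiv_def)
  qed
  \<comment> \<open>Removing the open set \<open>U\<close> keeps compactness and takes away every
    critical point, so negative powers of \<open>norm (grad u x)\<close> are continuous on
    \<open>T\<close>.\<close>
  define T where "T = S - U"
  have T: "compact T" "T \<subseteq> ext_ball" using S(2,3) U(2) by (auto simp: T_def compact_diff)
  have gT: "grad \<phi> x = 0" if "x \<notin> T" for x using gU[of x] S(5)[of x] that by (auto simp: T_def)
  have uT: "grad u x \<noteq> 0" if "x \<in> T" for x
    using that U(3) S(3) by (auto simp: T_def crit_set_def)
  have wu: "is_weak_grad u (grad u)" by (rule is_weak_grad_C1[OF u(2)])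
  have w\<phi>: "is_weak_grad \<phi> (grad \<phi>)" by (rule is_weak_grad_C1c[OF U(1)])
  note m [measurable] = weak_grad_measurable[OF wu] weak_grad_measurable[OF w\<phi>]
  define \<alpha> where "\<alpha> x = norm (grad u x) powr (p - 2) * (grad u x \<bullet> grad \<phi> x)" for x
  define \<beta> where "\<beta> x = norm (grad u x) powr (p - 2) * (norm (grad \<phi> x))\<^sup>2" for x
  have c: "continuous_on T (grad u)" "continuous_on T (grad \<phi>)"
    using C1_onD(2)[OF u(2)] T(2) continuous_on_subset C1c_continuous_on(2)[OF U(1)] by blast+
  have cp: "continuous_on T (\<lambda>x. norm (grad u x) powr (p - 2))"
    using c(1) uT by (intro continuous_on_powr continuous_on_norm continuous_on_const) auto
  have i\<alpha>: "integrable ext_leb \<alpha>"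
  proof (rule integrable_continuous_compact[OF _ T])
    show "\<alpha> \<in> borel_measurable ext_leb" unfolding \<alpha>_def[abs_def] by measurable
    show "continuous_on T \<alpha>" unfolding \<alpha>_def[abs_def] by (intro continuous_on_mult cp continuous_on_inner c)
  qed (simp add: \<alpha>_def gT)
  have i\<beta>: "integrable ext_leb \<beta>"
  proof (rule integrable_continuous_compact[OF _ T])
    show "\<beta> \<in> borel_measurable ext_leb" unfolding \<beta>_def[abs_def] by measurable
    show "continuous_on T \<beta>" unfolding \<beta>_def[abs_def] by (intro continuous_on_mult cp continuous_on_power continuous_on_norm c)
  qed (simp add: \<beta>_def gT)
  have iu: "integrable ext_leb (\<lambda>x. norm (grad u x) powr p)"
  proof -
    have "integrable ext_leb (\<lambda>x. norm (wgrad u x) powr p)" using u(1) unfolding D01p_def by auto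
    moreover have "integrable ext_leb (\<lambda>x. norm (wgrad u x) powr p) \<longleftrightarrow> integrable ext_leb (\<lambda>x. norm (grad u x) powr p)"
      by (rule integrable_cong_AE)
         (use wgrad_AE_eq[OF wu] m weak_grad_measurable[OF is_weak_grad_wgrad[OF wu]] in auto)
    ultimately show ?thesis by simp
  qed
  have "dirichlet p (\<lambda>x. u x + e * \<phi> x)
      \<le> dirichlet p u + (p * integral\<^sup>L ext_leb \<alpha>) * e + (p / 2 * integral\<^sup>L ext_leb \<beta>) * e\<^sup>2" for e
  proof -
    have w: "is_weak_grad (\<lambda>x. u x + e * \<phi> x) (\<lambda>x. grad u x + e *\<^sub>R grad \<phi> x)"
      using is_weak_grad_lincomb[OF wu w\<phi>, of 1 e] by simp
    have ir: "integrable ext_leb (\<lambda>x. norm (grad u x) powr p + ((p * e) * \<alpha> x + (p / 2 * e\<^sup>2) * \<beta> x))"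
      using iu i\<alpha> i\<beta> by (intro Bochner_Integration.integrable_add integrable_mult_right) auto
    have i\<phi>: "integrable ext_leb (\<lambda>x. norm (grad u x + e *\<^sub>R grad \<phi> x) powr p)"
      using integrable_lincomb_powr[OF p(1) m(1) iu m(2) C1c_grad_powr_integrable[OF U(1) p(1)], of 1 e] by simp
    have "dirichlet p (\<lambda>x. u x + e * \<phi> x) = (LINT x|ext_leb. norm (grad u x + e *\<^sub>R grad \<phi> x) powr p)"
      by (rule dirichlet_eq[OF w])
    also have "\<dots> \<le> (LINT x|ext_leb. norm (grad u x) powr p + ((p * e) * \<alpha> x + (p / 2 * e\<^sup>2) * \<beta> x))"
    proof (rule integral_mono[OF i\<phi> ir])
      fix x :: 'a
      show "norm (grad u x + e *\<^sub>R grad \<phi> x) powr p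
        \<le> norm (grad u x) powr p + ((p * e) * \<alpha> x + (p / 2 * e\<^sup>2) * \<beta> x)"
      \<comment> \<open>Off \<open>T\<close>, critical points included, \<open>grad \<phi>\<close>
        vanishes and both sides reduce to \<open>norm (grad u x) powr p\<close>.\<close>
      proof (cases "x \<in> T")
        case True
        show ?thesis using norm_add_powr_le[OF p uT[OF True], of "e *\<^sub>R grad \<phi> x"]
          by (simp add: \<alpha>_def \<beta>_def power_mult_distrib mult_ac)
      qed (simp add: \<alpha>_def \<beta>_def gT)
    qed
    also have "\<dots> = (LINT x|ext_leb. norm (grad u x) powr p) + (LINT x|ext_leb. (p * e) * \<alpha> x + (p / 2 * e\<^sup>2) * \<beta> x)"
      using iu i\<alpha> i\<beta> by (intro Bochner_Integration.integral_add Bochner_Integration.integrable_add integrable_mult_right) auto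
    also have "(LINT x|ext_leb. (p * e) * \<alpha> x + (p / 2 * e\<^sup>2) * \<beta> x)
        = (p * e) * integral\<^sup>L ext_leb \<alpha> + (p / 2 * e\<^sup>2) * integral\<^sup>L ext_leb \<beta>"
      using integral_lincomb[OF i\<alpha> i\<beta>, of "p * e" "p / 2 * e\<^sup>2"] by simp
    finally show ?thesis by (simp add: dirichlet_eq[OF wu] mult_ac)
  qed
  then show thesis by (rule that)
qed

text \<open>A positive continuous \<open>u\<close> is bounded away from 0 on the compact support of
  \<open>\<phi>\<close>, so even negative powers such as \<open>p - 2\<close> stay bounded there.
  The second integrand carries \<open>\<bar>K x\<bar>\<close> because it will dominate a remainder
  multiplied by a signed weight.\<close>

lemma integrable_weight_test:
  fixes u :: "'a::euclidean_space \<Rightarrow> real"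
  assumes K: "L1loc K" and u: "continuous_on ext_ball u" "\<And>x. x \<in> ext_ball \<Longrightarrow> 0 < u x" and \<phi>: "\<phi> \<in> C1c"
  shows "integrable ext_leb (\<lambda>x. K x * (u x powr r * \<phi> x))"
    "integrable ext_leb (\<lambda>x. \<bar>K x\<bar> * (u x powr r * (\<phi> x)\<^sup>2))"
proof -
  obtain S where S: "compact S" "S \<subseteq> ext_ball" "\<And>x. x \<notin> S \<Longrightarrow> \<phi> x = 0"
    using C1cE[OF \<phi>] by metis
  have c: "continuous_on ext_ball (\<lambda>x. u x powr r)"
    using u by (intro continuous_on_powr continuous_on_const) (auto simp: less_imp_neq[symmetric])
  note c\<phi> = C1c_continuous_on(1)[OF \<phi>, of ext_ball]
  have "integrable ext_leb (\<lambda>x. (u x powr r * \<phi> x) *\<^sub>R K x)"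
    by (rule integrable_mult_compact[OF K S(1,2) continuous_on_mult[OF c c\<phi>]]) (simp add: S(3))
  then show "integrable ext_leb (\<lambda>x. K x * (u x powr r * \<phi> x))" by (simp add: mult_ac)
  have "integrable ext_leb (\<lambda>x. (u x powr r * (\<phi> x)\<^sup>2) *\<^sub>R K x)"
    by (rule integrable_mult_compact[OF K S(1,2) continuous_on_mult[OF c continuous_on_power[OF c\<phi>]]]) (simp add: S(3))
  then have "integrable ext_leb (\<lambda>x. norm ((u x powr r * (\<phi> x)\<^sup>2) *\<^sub>R K x))" by (rule integrable_norm)
  then show "integrable ext_leb (\<lambda>x. \<bar>K x\<bar> * (u x powr r * (\<phi> x)\<^sup>2))"
    by (simp add: abs_mult mult_ac)
qed

text \<open>The remainder \<open>r\<close> of the power after its linear term lies between 0 and a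
  quadratic in \<open>e\<close>. Whatever the sign of \<open>K x\<close>, the product
  \<open>K x * r\<close> is then at least minus \<open>\<bar>K x\<bar>\<close> times that
  quadratic.\<close>

lemma potential_C1_ge:
  fixes u :: "'a::euclidean_space \<Rightarrow> real"
  assumes p: "1 < p" "p < 2" and K: "L1loc K"
    and u: "continuous_on ext_ball u" "\<And>x. x \<in> ext_ball \<Longrightarrow> 0 < u x"
    and int: "integrable ext_leb (\<lambda>x. K x * \<bar>u x\<bar> powr p)" and \<phi>: "\<phi> \<in> C1c"
  obtains A B where "\<And>e. potential p K u + A * e + B * e\<^sup>2 \<le> potential p K (\<lambda>x. u x + e * \<phi> x)"
proof -
  define \<alpha> where "\<alpha> x = K x * (u x powr (p - 1) * \<phi> x)" for x
  define \<beta> where "\<beta> x = \<bar>K x\<bar> * (u x powr (p - 2) * (\<phi> x)\<^sup>2)" for x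
  have i\<alpha>: "integrable ext_leb \<alpha>" and i\<beta>: "integrable ext_leb \<beta>"
    using integrable_weight_test[OF K u \<phi>] unfolding \<alpha>_def[abs_def] \<beta>_def[abs_def] by blast+
  have m [measurable]: "u \<in> borel_measurable ext_leb" "\<phi> \<in> borel_measurable ext_leb" "K \<in> borel_measurable ext_leb"
    using u(1) C1c_continuous_on(1)[OF \<phi>] L1loc_measurable[OF K] continuous_ext_measurable by blast+
  have est: "\<bar>K x * \<bar>u x + e * \<phi> x\<bar> powr p - (K x * \<bar>u x\<bar> powr p + (p * e) * \<alpha> x)\<bar> \<le> (p / 2 * e\<^sup>2) * \<beta> x"
    if x: "x \<in> ext_ball" for x e
  proof -
    define r where "r = \<bar>u x + e * \<phi> x\<bar> powr p - (u x powr p + p * u x powr (p - 1) * (e * \<phi> x))"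
    have "0 \<le> r" using abs_add_powr_ge[OF p(1) u(2)[OF x], of "e * \<phi> x"] by (simp add: r_def)
    moreover have "r \<le> p / 2 * u x powr (p - 2) * (e * \<phi> x)\<^sup>2"
      using abs_add_powr_le[OF _ p(2) u(2)[OF x], of "e * \<phi> x"] p by (simp add: r_def)
    ultimately have "\<bar>K x * r\<bar> \<le> \<bar>K x\<bar> * (p / 2 * u x powr (p - 2) * (e * \<phi> x)\<^sup>2)"
      unfolding abs_mult by (intro mult_left_mono) auto
    moreover have "K x * r = K x * \<bar>u x + e * \<phi> x\<bar> powr p - (K x * \<bar>u x\<bar> powr p + (p * e) * \<alpha> x)"
      using u(2)[OF x] by (simp add: r_def \<alpha>_def algebra_simps)
    moreover have "\<bar>K x\<bar> * (p / 2 * u x powr (p - 2) * (e * \<phi> x)\<^sup>2) = (p / 2 * e\<^sup>2) * \<beta> x"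
      by (simp add: \<beta>_def power_mult_distrib mult_ac)
    ultimately show ?thesis by metis
  qed
  have "potential p K u + (p * integral\<^sup>L ext_leb \<alpha>) * e + (- (p / 2 * integral\<^sup>L ext_leb \<beta>)) * e\<^sup>2
      \<le> potential p K (\<lambda>x. u x + e * \<phi> x)" for e
  proof -
    have i1: "integrable ext_leb (\<lambda>x. (p * e) * \<alpha> x + (- (p / 2 * e\<^sup>2)) * \<beta> x)"
      using i\<alpha> i\<beta> by (intro Bochner_Integration.integrable_add integrable_mult_right) auto
    have i2: "integrable ext_leb (\<lambda>x. K x * \<bar>u x\<bar> powr p + (p * e) * \<alpha> x)"
      using i\<alpha> int by (intro Bochner_Integration.integrable_add integrable_mult_right) auto
    \<comment> \<open>Integrability for \<open>u + e * \<phi>\<close> is obtained by dominating the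
      deviation from the first-order expansion by a multiple of \<open>\<beta>\<close> and adding
      the expansion back.\<close>
    have i3: "integrable ext_leb (\<lambda>x. K x * \<bar>u x + e * \<phi> x\<bar> powr p - (K x * \<bar>u x\<bar> powr p + (p * e) * \<alpha> x))"
    proof (rule Bochner_Integration.integrable_bound)
      show "integrable ext_leb (\<lambda>x. (p / 2 * e\<^sup>2) * \<beta> x)" using i\<beta> by (intro integrable_mult_right) auto
      show "(\<lambda>x. K x * \<bar>u x + e * \<phi> x\<bar> powr p - (K x * \<bar>u x\<bar> powr p + (p * e) * \<alpha> x)) \<in> borel_measurable ext_leb"
        unfolding \<alpha>_def by measurable
      show "AE x in ext_leb. norm (K x * \<bar>u x + e * \<phi> x\<bar> powr p - (K x * \<bar>u x\<bar> powr p + (p * e) * \<alpha> x))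
          \<le> norm ((p / 2 * e\<^sup>2) * \<beta> x)"
      proof (rule AE_I2)
        fix x :: 'a assume "x \<in> space ext_leb"
        then have "x \<in> ext_ball" by simp
        from est[OF this, of e] show "norm (K x * \<bar>u x + e * \<phi> x\<bar> powr p - (K x * \<bar>u x\<bar> powr p + (p * e) * \<alpha> x))
          \<le> norm ((p / 2 * e\<^sup>2) * \<beta> x)" unfolding real_norm_def by linarith
      qed
    qed
    have i4: "integrable ext_leb (\<lambda>x. K x * \<bar>u x + e * \<phi> x\<bar> powr p)"
      using Bochner_Integration.integrable_add[OF i3 i2] by simp
    have "(LINT x|ext_leb. K x * \<bar>u x\<bar> powr p + ((p * e) * \<alpha> x + (- (p / 2 * e\<^sup>2)) * \<beta> x))
        \<le> potential p K (\<lambda>x. u x + e * \<phi> x)"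
      unfolding potential_def
    proof (rule integral_mono[OF Bochner_Integration.integrable_add[OF int i1] i4])
      fix x :: 'a assume "x \<in> space ext_leb"
      then have "x \<in> ext_ball" by simp
      from est[OF this, of e]
      show "K x * \<bar>u x\<bar> powr p + ((p * e) * \<alpha> x + (- (p / 2 * e\<^sup>2)) * \<beta> x) \<le> K x * \<bar>u x + e * \<phi> x\<bar> powr p"
        unfolding minus_mult_left[symmetric] by linarith
    qed
    moreover have "(LINT x|ext_leb. K x * \<bar>u x\<bar> powr p + ((p * e) * \<alpha> x + (- (p / 2 * e\<^sup>2)) * \<beta> x))
        = potential p K u + ((p * e) * integral\<^sup>L ext_leb \<alpha> + (- (p / 2 * e\<^sup>2)) * integral\<^sup>L ext_leb \<beta>)"
      using Bochner_Integration.integral_add[OF int i1]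
        integral_lincomb[OF i\<alpha> i\<beta>, of "p * e" "- (p / 2 * e\<^sup>2)"] by (simp add: potential_def)
    ultimately show ?thesis by (simp add: mult_ac)
  qed
  then show thesis by (rule that)
qed

section \<open>The energy on the plane spanned by the eigenfunction and a test function\<close>

text \<open>The constant terms cancel because \<open>u\<close> has potential 1 and Dirichlet
  integral \<open>lambda1 p K\<close>. As \<open>lambda1 p K\<close> is nonnegative, the lower bound
  for the potential becomes an upper bound for the energy.\<close>

lemma energy_le_quadratic:
  assumes p: "1 < p" "p < 2" and K: "L1loc K"
    and u: "first_eigenfunction p K u" and \<phi>: "\<phi> \<in> Y_space u"
  obtains B where "0 \<le> B"
    "\<And>e. dirichlet p (\<lambda>x. u x + e * \<phi> x) - lambda1 p K * potential p K (\<lambda>x. u x + e * \<phi> x) \<le> B * e\<^sup>2"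
proof -
  have p0: "0 < p" using p by simp
  have uD: "u \<in> D01p p" "C1_on ext_ball u" "\<And>x. x \<in> ext_ball \<Longrightarrow> 0 < u x"
    and pu: "potential p K u = 1" and du: "dirichlet p u = lambda1 p K"
    using u unfolding first_eigenfunction_def potential_def dirichlet_def by auto
  have \<phi>C: "\<phi> \<in> C1c" using \<phi> unfolding Y_space_def by auto
  have l: "0 \<le> lambda1 p K" using dirichlet_nonneg[of p u] du by simp
  \<comment> \<open>A non-integrable function would have integral 0 by default, so the normalisation
    to 1 proves integrability.\<close>
  have int: "integrable ext_leb (\<lambda>x. K x * \<bar>u x\<bar> powr p)"
    using pu not_integrable_integral_eq[of ext_leb "\<lambda>x. K x * \<bar>u x\<bar> powr p"]
    unfolding potential_def by force
  obtain A1 B1 where 1: "\<And>e. dirichlet p (\<lambda>x. u x + e * \<phi> x) \<le> dirichlet p u + A1 * e + B1 * e\<^sup>2"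
    using dirichlet_C1_le[OF p0 p(2) uD(1,2) \<phi>] by blast
  obtain A2 B2 where 2: "\<And>e. potential p K u + A2 * e + B2 * e\<^sup>2 \<le> potential p K (\<lambda>x. u x + e * \<phi> x)"
    using potential_C1_ge[OF p K C1_onD(3)[OF uD(2)] uD(3) int \<phi>C] by blast
  define A B where "A = A1 - lambda1 p K * A2" and "B = B1 - lambda1 p K * B2"
  have le: "dirichlet p (\<lambda>x. u x + e * \<phi> x) - lambda1 p K * potential p K (\<lambda>x. u x + e * \<phi> x)
      \<le> A * e + B * e\<^sup>2" for e
  proof -
    have "lambda1 p K * (potential p K u + A2 * e + B2 * e\<^sup>2)
        \<le> lambda1 p K * potential p K (\<lambda>x. u x + e * \<phi> x)"
      by (rule mult_left_mono[OF 2 l])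
    then show ?thesis using 1[of e] by (simp add: A_def B_def pu du algebra_simps)
  qed
  have ge: "0 \<le> A * e + B * e\<^sup>2" for e
  proof -
    have "(\<lambda>x. u x + e * \<phi> x) \<in> D01p p"
      using D01p_lincomb[OF uD(1) C1c_subset_D01p[OF \<phi>C p0] p0, of 1 e] by simp
    from lambda1_potential_le[OF this p0 l] show ?thesis using le[of e] by linarith
  qed
  then have "A = 0" by (rule nonneg_quadratic_imp_linear_coeff_0)
  moreover from this have "0 \<le> B" using ge[of 1] by simp
  ultimately show thesis using le that[of B] by simp
qed

text \<open>Pulling out \<open>s\<close> leaves the parameter \<open>e = t / s\<close>, and
  \<open>\<bar>s\<bar> powr p * (t / s)\<^sup>2\<close> equals
  \<open>t\<^sup>2 * \<bar>s\<bar> powr (p - 2)\<close>. Both signs of \<open>s\<close> are covered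
  since the bound by \<open>B * e\<^sup>2\<close> holds for all real \<open>e\<close>.\<close>

lemma energy_le_homogeneous:
  assumes p: "0 < p" and u: "u \<in> D01p p" and \<phi>: "\<phi> \<in> D01p p"
    and B: "\<And>e. dirichlet p (\<lambda>x. u x + e * \<phi> x) - l * potential p K (\<lambda>x. u x + e * \<phi> x) \<le> B * e\<^sup>2"
    and s: "s \<noteq> 0"
  shows "dirichlet p (\<lambda>x. s * u x + t * \<phi> x) - l * potential p K (\<lambda>x. s * u x + t * \<phi> x)
    \<le> B * t\<^sup>2 * \<bar>s\<bar> powr (p - 2)"
proof -
  let ?v = "\<lambda>x. u x + t / s * \<phi> x"
  have eq: "(\<lambda>x. s * u x + t * \<phi> x) = (\<lambda>x. s * ?v x)"
    using s by (simp add: fun_eq_iff field_simps)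
  have v: "?v \<in> D01p p" using D01p_lincomb[OF u \<phi> p, of 1 "t / s"] by simp
  have "dirichlet p (\<lambda>x. s * ?v x) - l * potential p K (\<lambda>x. s * ?v x)
      = \<bar>s\<bar> powr p * (dirichlet p ?v - l * potential p K ?v)"
    unfolding dirichlet_scale[OF v] potential_scale by (simp add: algebra_simps)
  also have "\<dots> \<le> \<bar>s\<bar> powr p * (B * (t / s)\<^sup>2)"
    by (rule mult_left_mono[OF B]) simp
  also have "\<dots> = B * t\<^sup>2 * (\<bar>s\<bar> powr p / s\<^sup>2)" by (simp add: power_divide)
  also have "\<bar>s\<bar> powr p / s\<^sup>2 = \<bar>s\<bar> powr (p - 2)"
    using s by (simp add: powr_diff)
  finally show ?thesis unfolding eq .
qed

section \<open>Projection of the perturbation and choice of the threshold\<close>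

theorem proposition4p7:
  fixes p :: real
    and K \<phi>1 :: "real ^ 'n \<Rightarrow> real"
    and h :: "(real ^ 'n \<Rightarrow> real) \<Rightarrow> real"
  assumes "2 \<le> CARD('n)"
    and "1 < p" and "p < 2"
    and "admissible_weight p K"
    and "\<And>R. 1 < R \<Longrightarrow> \<exists>C. AE x in lebesgue_on (annulus R). \<bar>K x\<bar> \<le> C"
    and "first_eigenfunction p K \<phi>1"
    and "h \<in> X_Y_dual p \<phi>1"
    and "h \<phi>1 = 0"
  shows "\<forall>M>0. \<exists>\<tau>0>0. \<forall>\<tau>>\<tau>0. \<exists>v_plus \<in> X_perp p K \<phi>1. \<exists>v_minus \<in> X_perp p K \<phi>1.
    max (J_fun p K h (\<lambda>x. \<tau> * \<phi>1 x + v_plus x))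
        (J_fun p K h (\<lambda>x. - \<tau> * \<phi>1 x + v_minus x)) < - M"
proof (intro allI impI)
  fix M :: real assume M: "M > 0"
  have p0: "0 < p" using assms(2) by simp
  have K: "L1loc K" using assms(4) unfolding admissible_weight_def by auto
  have \<phi>1: "\<phi>1 \<in> D01p p" "C1_on ext_ball \<phi>1" "\<And>x. x \<in> ext_ball \<Longrightarrow> 0 < \<phi>1 x"
    and norm1: "(LINT x|ext_leb. K x * \<bar>\<phi>1 x\<bar> powr p) = 1"
    using assms(6) unfolding first_eigenfunction_def by auto
  obtain \<phi> where \<phi>Y: "\<phi> \<in> Y_space \<phi>1" and h\<phi>: "h \<phi> \<noteq> 0" and hD: "h \<in> D01p_dual p"
    using assms(7) unfolding X_Y_dual_def by auto
  have h_add: "h (\<lambda>x. u x + v x) = h u + h v" if "u \<in> D01p p" "v \<in> D01p p" for u v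
    using hD that by (simp add: D01p_dual_def)
  have h_scale: "h (\<lambda>x. c * u x) = c * h u" if "u \<in> D01p p" for c u
    using hD that by (simp add: D01p_dual_def)
  have \<phi>C: "\<phi> \<in> C1c" using \<phi>Y unfolding Y_space_def by auto
  have \<phi>D: "\<phi> \<in> D01p p" by (rule C1c_subset_D01p[OF \<phi>C p0])
  obtain B where B: "0 \<le> B"
    "\<And>e. dirichlet p (\<lambda>x. \<phi>1 x + e * \<phi> x) - lambda1 p K * potential p K (\<lambda>x. \<phi>1 x + e * \<phi> x) \<le> B * e\<^sup>2"
    using energy_le_quadratic[OF assms(2,3) K assms(6) \<phi>Y] by blast
  define t where "t = (M + 1) / h \<phi>"
  define c where "c = (LINT x|ext_leb. K x * (\<phi>1 x powr (p - 1) * \<phi> x))"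
  \<comment> \<open>The coefficient of the projection is \<open>c\<close> divided by the potential
    of \<open>\<phi>1\<close>, which is 1.\<close>
  define v where "v x = t * \<phi> x + (- (t * c)) * \<phi>1 x" for x
  have v: "v \<in> X_perp p K \<phi>1"
  proof -
    have i1: "integrable ext_leb (\<lambda>x. K x * (\<phi>1 x powr (p - 1) * \<phi> x))"
      by (rule integrable_weight_test(1)[OF K C1_onD(3)[OF \<phi>1(2)] \<phi>1(3) \<phi>C])
    have i2: "integrable ext_leb (\<lambda>x. K x * \<bar>\<phi>1 x\<bar> powr p)"
      using norm1 not_integrable_integral_eq[of ext_leb "\<lambda>x. K x * \<bar>\<phi>1 x\<bar> powr p"] by force
    have "(LINT x|ext_leb. K x * \<phi>1 x powr (p - 1) * v x)
        = (LINT x|ext_leb. t *\<^sub>R (K x * (\<phi>1 x powr (p - 1) * \<phi> x)) + (- (t * c)) *\<^sub>R (K x * \<bar>\<phi>1 x\<bar> powr p))"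
    proof (rule Bochner_Integration.integral_cong[OF refl])
      fix x :: "real ^ 'n" assume "x \<in> space ext_leb"
      then have "0 < \<phi>1 x" using \<phi>1(3) by simp
      then have "\<bar>\<phi>1 x\<bar> powr p = \<phi>1 x powr (p - 1) * \<phi>1 x" by (simp add: powr_diff)
      then show "K x * \<phi>1 x powr (p - 1) * v x
        = t *\<^sub>R (K x * (\<phi>1 x powr (p - 1) * \<phi> x)) + (- (t * c)) *\<^sub>R (K x * \<bar>\<phi>1 x\<bar> powr p)"
        by (simp add: v_def algebra_simps)
    qed
    also have "\<dots> = 0" unfolding integral_lincomb[OF i1 i2] norm1 by (simp add: c_def)
    finally have "(LINT x|ext_leb. K x * \<phi>1 x powr (p - 1) * v x) = 0" .
    moreover have "v \<in> D01p p" unfolding v_def[abs_def] by (rule D01p_lincomb[OF \<phi>D \<phi>1(1) p0])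
    ultimately show ?thesis unfolding X_perp_def by simp
  qed
  have J: "J_fun p K h (\<lambda>x. s * \<phi>1 x + t * \<phi> x) \<le> B * t\<^sup>2 * \<bar>s\<bar> powr (p - 2) / p - (M + 1)"
    if s: "s \<noteq> 0" for s
  proof -
    have sD: "(\<lambda>x. s * \<phi>1 x) \<in> D01p p" "(\<lambda>x. t * \<phi> x) \<in> D01p p"
      using D01p_lincomb[OF \<phi>1(1) \<phi>D p0, of s 0] D01p_lincomb[OF \<phi>1(1) \<phi>D p0, of 0 t] by simp_all
    have "h (\<lambda>x. s * \<phi>1 x + t * \<phi> x) = h (\<lambda>x. s * \<phi>1 x) + h (\<lambda>x. t * \<phi> x)"
      by (rule h_add[OF sD])
    also have "\<dots> = s * h \<phi>1 + t * h \<phi>" by (simp only: h_scale \<phi>1(1) \<phi>D)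
    finally have hv: "h (\<lambda>x. s * \<phi>1 x + t * \<phi> x) = M + 1" using h\<phi> assms(8) by (simp add: t_def)
    have "J_fun p K h (\<lambda>x. s * \<phi>1 x + t * \<phi> x) = (dirichlet p (\<lambda>x. s * \<phi>1 x + t * \<phi> x)
        - lambda1 p K * potential p K (\<lambda>x. s * \<phi>1 x + t * \<phi> x)) / p - (M + 1)"
      unfolding J_fun_def hv dirichlet_def[symmetric] potential_def[symmetric] by (simp add: diff_divide_distrib)
    also have "\<dots> \<le> B * t\<^sup>2 * \<bar>s\<bar> powr (p - 2) / p - (M + 1)"
      using energy_le_homogeneous[OF p0 \<phi>1(1) \<phi>D B(2) s, of t] p0 by (simp add: divide_right_mono)
    finally show ?thesis .
  qed
  have "((\<lambda>s. B * t\<^sup>2 * s powr (p - 2) / p) \<longlongrightarrow> B * t\<^sup>2 * 0 / p) at_top"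
    using assms(3) p0 by (intro tendsto_intros tendsto_neg_powr filterlim_ident) auto
  \<comment> \<open>The surplus 1 in \<open>t * h \<phi> = M + 1\<close> is what the energy term may
    use up.\<close>
  then have "\<forall>\<^sub>F s in at_top. B * t\<^sup>2 * s powr (p - 2) / p < 1"
    by (rule order_tendstoD(2)) simp
  then obtain s0 where s0: "\<And>s. s \<ge> s0 \<Longrightarrow> B * t\<^sup>2 * s powr (p - 2) / p < 1"
    unfolding eventually_at_top_linorder by blast
  \<comment> \<open>Since \<open>r * \<phi>1 + v\<close> is
    \<open>(r - t * c) * \<phi>1 + t * \<phi>\<close>, the projection shifts the parameter by
    \<open>t * c\<close>. The summand \<open>\<bar>t * c\<bar>\<close> absorbs this shift; the
    others keep the shifted parameter nonzero and of modulus at least \<open>s0\<close>, and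
    \<open>\<tau>0\<close> positive.\<close>
  define \<tau>0 where "\<tau>0 = max s0 0 + \<bar>t * c\<bar> + 1"
  have J_lt: "J_fun p K h (\<lambda>x. r * \<phi>1 x + v x) < - M" if r: "\<tau>0 < \<bar>r\<bar>" for r
  proof -
    have "\<bar>r - t * c\<bar> \<ge> s0" "r - t * c \<noteq> 0" using r unfolding \<tau>0_def by linarith+
    moreover have "(\<lambda>x. r * \<phi>1 x + v x) = (\<lambda>x. (r - t * c) * \<phi>1 x + t * \<phi> x)"
      by (simp add: fun_eq_iff v_def algebra_simps)
    ultimately show ?thesis using J[of "r - t * c"] s0[of "\<bar>r - t * c\<bar>"] by simp
  qed
  \<comment> \<open>\<open>J_lt\<close> depends only on the modulus of \<open>r\<close>, so the same
    \<open>v\<close> serves both signs and every \<open>\<tau>\<close>.\<close>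
  have "max (J_fun p K h (\<lambda>x. \<tau> * \<phi>1 x + v x)) (J_fun p K h (\<lambda>x. - \<tau> * \<phi>1 x + v x)) < - M"
    if "\<tau>0 < \<tau>" for \<tau>
    using J_lt[of \<tau>] J_lt[of "- \<tau>"] that by simp
  moreover have "\<tau>0 > 0" by (simp add: \<tau>0_def)
  ultimately show "\<exists>\<tau>0>0. \<forall>\<tau>>\<tau>0. \<exists>v_plus \<in> X_perp p K \<phi>1. \<exists>v_minus \<in> X_perp p K \<phi>1.
    max (J_fun p K h (\<lambda>x. \<tau> * \<phi>1 x + v_plus x)) (J_fun p K h (\<lambda>x. - \<tau> * \<phi>1 x + v_minus x)) < - M"
    using v by blast
qed

end
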